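(* Consider, for each $n\in\mathbb N$, the network primitives $Q^n(0)$, $N^{A,n}_i$, $N^{D,n}_i$, $\Phi^n_{ij}$, $\lambda^n_i$, $\mu^n_i$ ($1\le i,j\le K$) described in the context. Assume that (A0) for each $n\in\mathbb N$ and each $i\in\mathcal J$, $\limsup_{t\to\infty}N^{A,n}_i(t)/t<\infty$ a.s.; (A2) for each $i\in\{1,\dots,K\}$, $\sup_{n\in\mathbb N}\sup_{x\in S}\Bigl(\frac{\lambda^n_i(nx)}{n(1+|x|)}+\frac{\mu^n_i(nx)}{n(1+|x|)}\Bigr)<\infty$. Then the system of equations, for $t\ge0$ and $1\le i\le K$, $$Q^n_i(t)=Q^n_i(0)+A^n_i(t)+B^n_i(t)-D^n_i(t),$$ $$A^n_i(t)=N^{A,n}_i\Bigl(\int_0^t\lambda^n_i(Q^n(s))\,ds\Bigr),\qquad B^n_i(t)=\sum_{j=1}^K\Phi^n_{ji}(D^n_j(t)),$$ $$D^n_i(t)=N^{D,n}_i\Bigl(\int_0^t\mu^n_i(Q^n(s))1_{\{Q^n_i(s)>0\}}\,ds\Bigr)$$ admits a unique strong solution $Q^n=(Q^n_1,\dots,Q^n_K)$, which is a $\mathbb Z_+^K$-valued stochastic process.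
   Context: $K\ge1$ is an integer, $S=\mathbb R_+^K$, $|\cdot|$ is the Euclidean norm, $\lfloor\cdot\rfloor$ is the integer part. All random objects are defined on a common probability space. $\mathbb D([0,\infty),\mathbb R)$ is the Skorohod space of right-continuous functions with left limits. The equations describe an open network of $K$ single-server stations with infinite buffers and first-in-first-out service; $Q^n_i(t)$ is the number of customers at station $i$ at time $t$, and $A^n_i(t)$, $B^n_i(t)$, $D^n_i(t)$ are the cumulative numbers of exogenous arrivals at, endogenous arrivals at, and departures from station $i$ during $[0,t]$. $\mathcal J\subseteq\{1,\dots,K\}$ is the set of stations with exogenous arrivals. For each $n\in\mathbb N$ and $1\le i\le K$: $\lambda^n_i,\mu^n_i:S\to\mathbb R_+$ are Borel functions, with $\lambda^n_i\equiv0$ if $i\notin\mathcal J$. $N^{A,n}_i$ and $N^{D,n}_i$ are nondecreasing $\mathbb Z_+$-valued processes with trajectories in $\mathbb D([0,\infty),\mathbb R)$ and with $N^{A,n}_i(0)=N^{D,n}_i(0)=0$; by convention $N^{A,n}_i(t)=\lfloor t\rfloor$ if $i\notin\mathcal J$. $\Phi^n_{ij}(m)$ is the cumulative number of customers, among the first $m$ customers departing station $i$, that go directly to station $j$; thus $\Phi^n_{ij}(0)=0$, each increment $\Phi^n_{ij}(m)-\Phi^n_{ij}(m-1)$ is in $\{0,1\}$, and $\sum_j(\Phi^n_{ij}(m)-\Phi^n_{ij}(m-1))\le1$. The initial queue length vector $Q^n(0)$ is $\mathbb Z_+^K$-valued. A solution is a process $Q^n$ satisfying the equations a.s. for all $t\ge0$.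 It is a strong solution if it is a (suitably) measurable function of $Q^n(0)$, $N^{A,n}=(N^{A,n}_i)_i$, $N^{D,n}=(N^{D,n}_i)_i$ and $\Phi^n=(\Phi^n_{ij})_{i,j}$; uniqueness means that any two solutions with the same primitives coincide a.s.
   Formalization: The processes N^{D,n}_i are additionally assumed to have jumps of size at most 1; without this the claim fails, e.g. K=1, J empty, Q(0)=1, mu=1, Phi=0, N^D(t)=2⌊t⌋ admits no Z_+-valued solution. *)

theory Defs
  imports "HOL-Probability.Probability"
begin

section \<open>State space and path space\<close>

text \<open>The $K$ stations are the elements of a finite type \<open>'k\<close>, so that
  $\mathbf R^K$ is \<open>real ^ 'k\<close> and $\mathbf Z_+^K$ is \<open>nat ^ 'k\<close>.\<close>

definition orthant :: "(real ^ 'k::finite) set" where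
  "orthant = {x. \<forall>i. 0 \<le> x $ i}"

definition real_vec :: "nat ^ 'k::finite \<Rightarrow> real ^ 'k" where
  "real_vec q = (\<chi> i. real (q $ i))"

text \<open>Paths are functions on all of \<open>real\<close> of which only the values on $[0,\infty)$ matter.\<close>

definition cadlag :: "(real \<Rightarrow> real) \<Rightarrow> bool" where
  "cadlag f \<longleftrightarrow> (\<forall>t\<ge>0. (f \<longlongrightarrow> f t) (at_right t)) \<and> (\<forall>t>0. \<exists>l. (f \<longlongrightarrow> l) (at_left t))"

text \<open>The space $D([0,\infty),\mathbf R)$ with the sigma-algebra generated by the coordinate
  projections, which is the Borel sigma-algebra of the Skorohod topology.\<close>

definition skorohod_space :: "(real \<Rightarrow> real) measure" where
  "skorohod_space = restrict_space (PiM {0..} (\<lambda>_. borel)) {f. cadlag f}"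


section \<open>Network primitives\<close>

text \<open>The primitives of one network. The last condition on \<open>ND\<close> says that its jumps have size
  at most one: a single server completes one service at a time. It is needed, since with
  batches of service completions a queue length could become negative.\<close>

locale network_primitives = prob_space M
  for M :: "'w measure" +
  fixes J :: "'k::finite set"
    and lam mu :: "'k \<Rightarrow> real ^ 'k \<Rightarrow> real"
    and Q0 :: "'w \<Rightarrow> nat ^ 'k"
    and NA ND :: "'k \<Rightarrow> real \<Rightarrow> 'w \<Rightarrow> nat"
    and Phi :: "'k \<Rightarrow> 'k \<Rightarrow> nat \<Rightarrow> 'w \<Rightarrow> nat"
  assumes lam_borel: "lam i \<in> borel_measurable (restrict_space borel orthant)"
    and lam_nonneg: "x \<in> orthant \<Longrightarrow> 0 \<le> lam i x"
    and lam_zero: "i \<notin> J \<Longrightarrow> x \<in> orthant \<Longrightarrow> lam i x = 0"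
    and mu_borel: "mu i \<in> borel_measurable (restrict_space borel orthant)"
    and mu_nonneg: "x \<in> orthant \<Longrightarrow> 0 \<le> mu i x"
    and Q0_measurable: "Q0 \<in> measurable M (count_space UNIV)"
    and NA_measurable: "0 \<le> t \<Longrightarrow> NA i t \<in> measurable M (count_space UNIV)"
    and NA_0: "\<omega> \<in> space M \<Longrightarrow> NA i 0 \<omega> = 0"
    and NA_mono: "\<omega> \<in> space M \<Longrightarrow> mono_on {0..} (\<lambda>t. NA i t \<omega>)"
    and NA_cadlag: "\<omega> \<in> space M \<Longrightarrow> cadlag (\<lambda>t. real (NA i t \<omega>))"
    and NA_floor: "i \<notin> J \<Longrightarrow> \<omega> \<in> space M \<Longrightarrow> 0 \<le> t \<Longrightarrow> NA i t \<omega> = nat \<lfloor>t\<rfloor>"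
    and ND_measurable: "0 \<le> t \<Longrightarrow> ND i t \<in> measurable M (count_space UNIV)"
    and ND_0: "\<omega> \<in> space M \<Longrightarrow> ND i 0 \<omega> = 0"
    and ND_mono: "\<omega> \<in> space M \<Longrightarrow> mono_on {0..} (\<lambda>t. ND i t \<omega>)"
    and ND_cadlag: "\<omega> \<in> space M \<Longrightarrow> cadlag (\<lambda>t. real (ND i t \<omega>))"
    and ND_jumps: "\<omega> \<in> space M \<Longrightarrow> 0 < t \<Longrightarrow>
      real (ND i t \<omega>) - Lim (at_left t) (\<lambda>s. real (ND i s \<omega>)) \<le> 1"
    and Phi_measurable: "Phi i j m \<in> measurable M (count_space UNIV)"
    and Phi_0: "\<omega> \<in> space M \<Longrightarrow> Phi i j 0 \<omega> = 0"
    and Phi_increment: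
      "\<omega> \<in> space M \<Longrightarrow> int (Phi i j (Suc m) \<omega>) - int (Phi i j m \<omega>) \<in> {0, 1}"
    and Phi_route:
      "\<omega> \<in> space M \<Longrightarrow> (\<Sum>j\<in>UNIV. int (Phi i j (Suc m) \<omega>) - int (Phi i j m \<omega>)) \<le> 1"


section \<open>The network equations\<close>

text \<open>For fixed paths \<open>na\<close>, \<open>nd\<close>, \<open>phi\<close> of the primitives and a queue length path \<open>q\<close>.\<close>

definition exo_arrivals ::
    "('k::finite \<Rightarrow> real ^ 'k \<Rightarrow> real) \<Rightarrow> ('k \<Rightarrow> real \<Rightarrow> nat) \<Rightarrow> (real \<Rightarrow> nat ^ 'k) \<Rightarrow> 'k \<Rightarrow> real \<Rightarrow> nat" where
  "exo_arrivals lam na q i t = na i (LBINT s:{0..t}. lam i (real_vec (q s)))"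

definition departures ::
    "('k::finite \<Rightarrow> real ^ 'k \<Rightarrow> real) \<Rightarrow> ('k \<Rightarrow> real \<Rightarrow> nat) \<Rightarrow> (real \<Rightarrow> nat ^ 'k) \<Rightarrow> 'k \<Rightarrow> real \<Rightarrow> nat" where
  "departures mu nd q i t =
     nd i (LBINT s:{0..t}. mu i (real_vec (q s)) * indicator {s. q s $ i > 0} s)"

definition endo_arrivals ::
    "('k::finite \<Rightarrow> real ^ 'k \<Rightarrow> real) \<Rightarrow> ('k \<Rightarrow> real \<Rightarrow> nat) \<Rightarrow> ('k \<Rightarrow> 'k \<Rightarrow> nat \<Rightarrow> nat) \<Rightarrow>
      (real \<Rightarrow> nat ^ 'k) \<Rightarrow> 'k \<Rightarrow> real \<Rightarrow> nat" where
  "endo_arrivals mu nd phi q i t = (\<Sum>j\<in>UNIV. phi j i (departures mu nd q j t))"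

text \<open>The integrability clauses say that the integrals in the equations are meaningful (a
  divergent or undefined Bochner integral would be \<open>0\<close>). They hold for every path with left and
  right limits; conversely, together with the equations they force the path to be
  right-continuous with left limits. The balance equation is stated over the reals since
  subtraction on \<open>nat\<close> truncates.\<close>

definition network_equations ::
    "('k::finite \<Rightarrow> real ^ 'k \<Rightarrow> real) \<Rightarrow> ('k \<Rightarrow> real ^ 'k \<Rightarrow> real) \<Rightarrow> nat ^ 'k \<Rightarrow>
      ('k \<Rightarrow> real \<Rightarrow> nat) \<Rightarrow> ('k \<Rightarrow> real \<Rightarrow> nat) \<Rightarrow> ('k \<Rightarrow> 'k \<Rightarrow> nat \<Rightarrow> nat) \<Rightarrow>
      (real \<Rightarrow> nat ^ 'k) \<Rightarrow> bool" where
  "network_equations lam mu q0 na nd phi q \<longleftrightarrow>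
     (\<forall>t\<ge>0. \<forall>i.
        set_integrable lborel {0..t} (\<lambda>s. lam i (real_vec (q s))) \<and>
        set_integrable lborel {0..t} (\<lambda>s. mu i (real_vec (q s)) * indicator {s. q s $ i > 0} s) \<and>
        real (q t $ i) = real (q0 $ i) + real (exo_arrivals lam na q i t)
          + real (endo_arrivals mu nd phi q i t) - real (departures mu nd q i t))"


section \<open>Solutions and strong solutions\<close>

definition network_solution ::
    "'w measure \<Rightarrow> ('k::finite \<Rightarrow> real ^ 'k \<Rightarrow> real) \<Rightarrow> ('k \<Rightarrow> real ^ 'k \<Rightarrow> real) \<Rightarrow>
      ('w \<Rightarrow> nat ^ 'k) \<Rightarrow> ('k \<Rightarrow> real \<Rightarrow> 'w \<Rightarrow> nat) \<Rightarrow> ('k \<Rightarrow> real \<Rightarrow> 'w \<Rightarrow> nat) \<Rightarrow>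
      ('k \<Rightarrow> 'k \<Rightarrow> nat \<Rightarrow> 'w \<Rightarrow> nat) \<Rightarrow> (real \<Rightarrow> 'w \<Rightarrow> nat ^ 'k) \<Rightarrow> bool" where
  "network_solution M lam mu Q0 NA ND Phi Q \<longleftrightarrow>
     (\<forall>t\<ge>0. Q t \<in> measurable M (count_space UNIV)) \<and>
     (AE \<omega> in M. network_equations lam mu (Q0 \<omega>) (\<lambda>i t. NA i t \<omega>) (\<lambda>i t. ND i t \<omega>)
        (\<lambda>i j m. Phi i j m \<omega>) (\<lambda>t. Q t \<omega>))"

type_synonym 'k primitive_data =
  "(nat ^ 'k) \<times> ('k \<Rightarrow> real \<Rightarrow> real) \<times> ('k \<Rightarrow> real \<Rightarrow> real) \<times> ('k \<times> 'k \<Rightarrow> nat \<Rightarrow> nat)"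

definition primitive_space :: "'k::finite primitive_data measure" where
  "primitive_space =
     count_space UNIV \<Otimes>\<^sub>M PiM UNIV (\<lambda>_. skorohod_space) \<Otimes>\<^sub>M PiM UNIV (\<lambda>_. skorohod_space)
       \<Otimes>\<^sub>M PiM UNIV (\<lambda>_. PiM UNIV (\<lambda>_. count_space UNIV))"

definition primitive_element ::
    "('w \<Rightarrow> nat ^ 'k::finite) \<Rightarrow> ('k \<Rightarrow> real \<Rightarrow> 'w \<Rightarrow> nat) \<Rightarrow> ('k \<Rightarrow> real \<Rightarrow> 'w \<Rightarrow> nat) \<Rightarrow>
      ('k \<Rightarrow> 'k \<Rightarrow> nat \<Rightarrow> 'w \<Rightarrow> nat) \<Rightarrow> 'w \<Rightarrow> 'k primitive_data" where
  "primitive_element Q0 NA ND Phi \<omega> =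
     (Q0 \<omega>, \<lambda>i. \<lambda>t\<in>{0..}. real (NA i t \<omega>), \<lambda>i. \<lambda>t\<in>{0..}. real (ND i t \<omega>),
      \<lambda>(i, j) m. Phi i j m \<omega>)"

definition strong_network_solution ::
    "'w measure \<Rightarrow> ('k::finite \<Rightarrow> real ^ 'k \<Rightarrow> real) \<Rightarrow> ('k \<Rightarrow> real ^ 'k \<Rightarrow> real) \<Rightarrow>
      ('w \<Rightarrow> nat ^ 'k) \<Rightarrow> ('k \<Rightarrow> real \<Rightarrow> 'w \<Rightarrow> nat) \<Rightarrow> ('k \<Rightarrow> real \<Rightarrow> 'w \<Rightarrow> nat) \<Rightarrow>
      ('k \<Rightarrow> 'k \<Rightarrow> nat \<Rightarrow> 'w \<Rightarrow> nat) \<Rightarrow> (real \<Rightarrow> 'w \<Rightarrow> nat ^ 'k) \<Rightarrow> bool" where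
  "strong_network_solution M lam mu Q0 NA ND Phi Q \<longleftrightarrow>
     network_solution M lam mu Q0 NA ND Phi Q \<and>
     (\<exists>F \<in> measurable primitive_space (PiM {0..} (\<lambda>_. count_space UNIV)).
        \<forall>\<omega>\<in>space M. \<forall>t\<ge>0. Q t \<omega> = F (primitive_element Q0 NA ND Phi \<omega>) t)"

end

theory Submission
  imports Defs
begin

text \<open>
  The arguments of the counting processes in the equations are clocks whose speeds depend only on
  the current values of the counters. As the counters are right-continuous step functions, two
  solutions cannot start to differ, and a solution is built from one change of a counter to the
  next. No queue length becomes negative: a station with empty queue has a stopped service clock,
  and the jumps of its service counter have size at most one.

  The construction does not explode: the total queue length is at most the initial one
  plus the number of exogenous arrivals, which by (A0) grows at most linearly in the clocks, so by
  (A2) the speeds are bounded linearly in the clocks. By Gronwall's inequality the clocks stay bounded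
  on bounded time intervals, and then so does the number of jumps. Each step of the construction
  is measurable in the primitives, hence so is the solution.
\<close>

section \<open>Systems of clocks\<close>

text \<open>The map \<open>F\<close> of a strong solution must be measurable on all of
  \<open>primitive_space\<close>, whose paths are arbitrary real-valued cadlag functions, perhaps
  neither monotone nor integral. The construction is therefore a total formula in the data made of
  countable operations, and its measurability is derived only from nonnegative rates and from
  measurable evaluation of the counters at random times. Monotonicity enters when the path is shown
  to solve the equations.

  Truncation serves the same end. Queue lengths are read off the counters by cutting negative
  balances at 0, so that every vector of counts has nonnegative rates. That nothing is cut off is
  proved afterwards, by induction along the steps of the construction; for a given solution it is
  contained in the equations.

  The cut-off of a step at length 1 covers states in which no counter ever changes again, and it
  allows the number of steps to be bounded by elapsed time plus total count.\<close>

text \<open>A finite family of counters \<open>N k\<close> is read at clocks \<open>u k\<close>, and the speed of every clock is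
  a function of the current values of all counters.\<close>

definition counts :: "('c \<Rightarrow> real \<Rightarrow> nat) \<Rightarrow> ('c \<Rightarrow> real) \<Rightarrow> 'c \<Rightarrow> nat" where
  "counts N u = (\<lambda>k. N k (u k))"

definition clock_solution ::
    "('c \<Rightarrow> real \<Rightarrow> nat) \<Rightarrow> (('c \<Rightarrow> nat) \<Rightarrow> 'c \<Rightarrow> real) \<Rightarrow> (real \<Rightarrow> 'c \<Rightarrow> nat) \<Rightarrow> bool" where
  "clock_solution N r c \<longleftrightarrow>
     (\<forall>t\<ge>0. \<forall>k. set_integrable lborel {0..t} (\<lambda>s. r (c s) k) \<and>
        c t k = N k (LBINT s:{0..t}. r (c s) k))"

text \<open>The time to the next change of a counter, cut off at \<open>1\<close>. Rational times suffice since the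
  counters are right-continuous; they make the infimum a measurable function of the data.\<close>

definition holding :: "('c \<Rightarrow> real \<Rightarrow> nat) \<Rightarrow> (('c \<Rightarrow> nat) \<Rightarrow> 'c \<Rightarrow> real) \<Rightarrow> ('c \<Rightarrow> real) \<Rightarrow> real" where
  "holding N r u =
     Inf (insert 1 {s \<in> \<rat>. 0 < s \<and> s < 1 \<and> (\<exists>k. N k (u k + r (counts N u) k * s) \<noteq> N k (u k))})"

primrec clocks ::
    "('c \<Rightarrow> real \<Rightarrow> nat) \<Rightarrow> (('c \<Rightarrow> nat) \<Rightarrow> 'c \<Rightarrow> real) \<Rightarrow> nat \<Rightarrow> 'c \<Rightarrow> real" where
  "clocks N r 0 = (\<lambda>k. 0)"
| "clocks N r (Suc m) =
     (\<lambda>k. clocks N r m k + r (counts N (clocks N r m)) k * holding N r (clocks N r m))"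

definition epoch :: "('c \<Rightarrow> real \<Rightarrow> nat) \<Rightarrow> (('c \<Rightarrow> nat) \<Rightarrow> 'c \<Rightarrow> real) \<Rightarrow> nat \<Rightarrow> real" where
  "epoch N r m = (\<Sum>j<m. holding N r (clocks N r j))"

text \<open>If the epochs are bounded and \<open>t\<close> lies beyond them, the minimum is taken over the empty set
  and the value is arbitrary.\<close>

definition jump_path ::
    "('c \<Rightarrow> real \<Rightarrow> nat) \<Rightarrow> (('c \<Rightarrow> nat) \<Rightarrow> 'c \<Rightarrow> real) \<Rightarrow> real \<Rightarrow> 'c \<Rightarrow> nat" where
  "jump_path N r t = counts N (clocks N r (LEAST m. t < epoch N r (Suc m)))"

text \<open>Naturals at distance less than 1 coincide, so convergence from the right already means
  equality near \<open>a\<close>.\<close>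

lemma cadlag_nat_right_constant:
  assumes "cadlag (\<lambda>t. real (f t))" "0 \<le> a"
  shows "\<exists>d>0. \<forall>x\<in>{a..<a + d}. f x = f a"
proof -
  have "((\<lambda>t. real (f t)) \<longlongrightarrow> real (f a)) (at_right a)"
    using assms by (auto simp: cadlag_def)
  then have "eventually (\<lambda>x. dist (real (f x)) (real (f a)) < 1) (at_right a)"
    by (rule tendstoD) simp
  then obtain b where b: "b > a" "\<And>y. a < y \<Longrightarrow> y < b \<Longrightarrow> dist (real (f y)) (real (f a)) < 1"
    unfolding eventually_at_right[OF less_add_one[of a]] by auto
  have const: "f x = f a" if "x \<in> {a..<a + (b - a)}" for x
  proof (cases "x = a")
    case False
    then have "dist (real (f x)) (real (f a)) < 1"
      using that b(2)[of x] by auto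
    then show ?thesis by (auto simp: dist_real_def)
  qed simp
  have "b - a > 0" using b(1) by simp
  with const show ?thesis by blast
qed

lemma set_lborel_integral_const_on:
  fixes f :: "real \<Rightarrow> real"
  assumes "a \<le> b" and f: "\<And>s. a \<le> s \<Longrightarrow> s < b \<Longrightarrow> f s = c"
  shows "set_integrable lborel {a..<b} f" "(LBINT s:{a..<b}. f s) = c * (b - a)"
proof -
  have "set_integrable lborel {a..<b} (\<lambda>_. c)"
    unfolding set_integrable_def using assms(1)
    by (intro integrable_scaleR_left integrable_real_indicator) (auto simp: emeasure_lborel_Ico)
  moreover have "set_integrable lborel {a..<b} (\<lambda>_. c) = set_integrable lborel {a..<b} f"
    by (rule set_integrable_cong) (auto simp: f)
  ultimately show "set_integrable lborel {a..<b} f" by simp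
  have "(LBINT s:{a..<b}. f s) = (LBINT s:{a..<b}. c)"
    by (rule set_lebesgue_integral_cong) (auto simp: f)
  also have "\<dots> = c * (b - a)"
    using assms(1) by (simp add: set_lebesgue_integral_def)
  finally show "(LBINT s:{a..<b}. f s) = c * (b - a)" .
qed

lemma set_lborel_integral_closed:
  fixes f :: "real \<Rightarrow> real"
  assumes "a \<le> b" "set_integrable lborel {a..<b} f"
  shows "set_integrable lborel {a..b} f" "(LBINT s:{a..b}. f s) = (LBINT s:{a..<b}. f s)"
proof -
  have eq: "indicat_real {b} s *\<^sub>R f s = indicat_real {b} s *\<^sub>R f b" for s
    by (auto simp: indicator_def)
  have b: "set_integrable lborel {b} f" "(LBINT s:{b}. f s) = 0"
    unfolding set_integrable_def set_lebesgue_integral_def eq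
    by (intro integrable_scaleR_left integrable_real_indicator) simp_all
  have ab: "{a..b} = {a..<b} \<union> {b}" using assms(1) by auto
  show "set_integrable lborel {a..b} f"
    unfolding ab by (rule set_integrable_Un) (use assms b in auto)
  have "(LBINT s:{a..b}. f s) = (LBINT s:{a..<b}. f s) + (LBINT s:{b}. f s)"
    unfolding ab by (rule set_integral_Un) (use assms b in auto)
  then show "(LBINT s:{a..b}. f s) = (LBINT s:{a..<b}. f s)" using b by simp
qed

section \<open>Uniqueness for a system of clocks\<close>

locale clock_system =
  fixes N :: "'c::finite \<Rightarrow> real \<Rightarrow> nat" and r :: "('c \<Rightarrow> nat) \<Rightarrow> 'c \<Rightarrow> real"
  assumes N_mono: "mono_on {0..} (N k)"
    and N_right_constant: "0 \<le> a \<Longrightarrow> \<exists>d>0. \<forall>x\<in>{a..<a + d}. N k x = N k a"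
    and r_nonneg: "0 \<le> r c k"
begin

lemma N_right_constant_uniform:
  assumes "\<And>k. 0 \<le> u k"
  shows "\<exists>d>0. \<forall>k. \<forall>x\<in>{u k..<u k + d}. N k x = N k (u k)"
proof -
  have "\<forall>k. \<exists>d>0. \<forall>x\<in>{u k..<u k + d}. N k x = N k (u k)"
    using N_right_constant assms by auto
  then obtain d where d: "\<And>k. d k > 0" "\<And>k x. x \<in> {u k..<u k + d k} \<Longrightarrow> N k x = N k (u k)"
    by metis
  have "Min (range d) > 0" using d(1) by auto
  moreover have "N k x = N k (u k)" if "x \<in> {u k..<u k + Min (range d)}" for k x
  proof (rule d(2))
    have "Min (range d) \<le> d k" by simp
    moreover have "u k \<le> x" "x < u k + Min (range d)" using that by simp_all
    ultimately show "x \<in> {u k..<u k + d k}" unfolding atLeastLessThan_iff by linarith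
  qed
  ultimately show ?thesis by blast
qed

text \<open>At the infimum \<open>T\<close> of the times of disagreement the clocks still coincide,
  hence so do the counters. Both solutions then keep this common value for a while, which
  contradicts the choice of \<open>T\<close>.\<close>

lemma clock_solution_unique:
  assumes c: "clock_solution N r c" and c': "clock_solution N r c'" and "0 \<le> t"
  shows "c t = c' t"
proof (rule ccontr)
  assume "c t \<noteq> c' t"
  define D where "D = {t. 0 \<le> t \<and> c t \<noteq> c' t}"
  have D: "t \<in> D" "bdd_below D" using \<open>c t \<noteq> c' t\<close> assms by (auto simp: D_def intro: bdd_belowI)
  define T where "T = Inf D"
  have T0: "0 \<le> T" unfolding T_def by (rule cInf_greatest) (use D in \<open>auto simp: D_def\<close>)
  have before: "c s = c' s" if "0 \<le> s" "s < T" for s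
    using that cInf_lower[OF _ D(2), of s] by (auto simp: T_def D_def)
  \<comment> \<open>A clock is an indefinite integral of a nonnegative rate, hence continuous and
    nondecreasing; just after \<open>T\<close> it stays in the window to the right of
    \<open>u k T\<close> where the counter is constant.\<close>
  have right: "\<exists>e>0. \<forall>s\<in>{T..<T + e}. b s = b T" if b: "clock_solution N r b" for b
  proof -
    define u where "u k s = integral {0..s} (\<lambda>s. r (b s) k)" for k s
    have I: "set_integrable lborel {0..s} (\<lambda>s. r (b s) k)" if "0 \<le> s" for s k
      using b that by (auto simp: clock_solution_def)
    have iv: "(LBINT s:{0..s}. r (b s) k) = u k s" if "0 \<le> s" for s k
      unfolding u_def using set_borel_integral_eq_integral(2)[OF I[OF that]] .
    have io: "(\<lambda>s. r (b s) k) integrable_on {0..s}" if "0 \<le> s" for s k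
      using set_borel_integral_eq_integral(1)[OF I[OF that]] .
    have bN: "b s k = N k (u k s)" if "0 \<le> s" for s k
      using b that iv by (auto simp: clock_solution_def)
    have mono: "u k s \<le> u k s'" if "0 \<le> s" "s \<le> s'" for k s s'
      unfolding u_def using that by (intro integral_subset_le io) (auto simp: r_nonneg)
    have u0: "0 \<le> u k T" for k
      unfolding u_def by (intro integral_nonneg io T0) (auto simp: r_nonneg)
    obtain d where d: "d > 0" "\<And>k x. x \<in> {u k T..<u k T + d} \<Longrightarrow> N k x = N k (u k T)"
      using N_right_constant_uniform[of "\<lambda>k. u k T"] u0 by blast
    have "\<exists>e>0. \<forall>s. T \<le> s \<longrightarrow> s < T + e \<longrightarrow> u k s < u k T + d" for k
    proof -
      have "continuous_on {0..T + 1} (u k)"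
        unfolding u_def using io[of "T + 1" k] T0 by (intro indefinite_integral_continuous_1) auto
      then have "\<exists>e>0. \<forall>s\<in>{0..T + 1}. dist s T < e \<longrightarrow> dist (u k s) (u k T) < d"
        using d(1) T0 unfolding continuous_on_iff by auto
      then obtain e where e: "e > 0" "\<And>s. s \<in> {0..T + 1} \<Longrightarrow> dist s T < e \<Longrightarrow> dist (u k s) (u k T) < d"
        by blast
      show ?thesis
      proof (intro exI[of _ "min e 1"] conjI allI impI)
        fix s assume "T \<le> s" "s < T + min e 1"
        then have "dist (u k s) (u k T) < d" using T0 by (intro e(2)) (auto simp: dist_real_def)
        then show "u k s < u k T + d" by (auto simp: dist_real_def)
      qed (use e in auto)
    qed
    then obtain e where e: "\<And>k. e k > 0" "\<And>k s. T \<le> s \<Longrightarrow> s < T + e k \<Longrightarrow> u k s < u k T + d"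
      by metis
    have "Min (range e) > 0" using e(1) by auto
    moreover have Me: "Min (range e) \<le> e k" for k by simp
    moreover have "b s = b T" if "s \<in> {T..<T + Min (range e)}" for s
    proof
      fix k
      have s: "T \<le> s" "s < T + Min (range e)" using that by simp_all
      with Me[of k] have "s < T + e k" by linarith
      with s have "u k s < u k T + d" by (intro e(2))
      then show "b s k = b T k"
        using that T0 d(2)[of "u k s" k] mono[of T s k] by (simp add: bN)
    qed
    ultimately show ?thesis by blast
  qed
  have "c T k = c' T k" for k
  proof -
    \<comment> \<open>Agreement before \<open>T\<close> suffices, since the point \<open>T\<close>
      is a null set.\<close>
    have "(LBINT s:{0..T}. r (c s) k) = (LBINT s:{0..T}. r (c' s) k)"
    proof -
      have "set_integrable lborel {0..<T} (\<lambda>s. r (b s) k)" if "clock_solution N r b" for b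
        by (rule set_integrable_subset[of _ "{0..T}"])
          (use that T0 in \<open>auto simp: clock_solution_def\<close>)
      then have "(LBINT s:{0..T}. r (b s) k) = (LBINT s:{0..<T}. r (b s) k)"
        if "clock_solution N r b" for b
        using that T0 by (intro set_lborel_integral_closed(2))
      moreover have "(LBINT s:{0..<T}. r (c s) k) = (LBINT s:{0..<T}. r (c' s) k)"
        by (rule set_lebesgue_integral_cong) (auto simp: before)
      ultimately show ?thesis using c c' by simp
    qed
    then show ?thesis using c c' T0 by (auto simp: clock_solution_def)
  qed
  then have cT: "c T = c' T" by auto
  obtain e where e: "e > 0" "\<And>s. s \<in> {T..<T + e} \<Longrightarrow> c s = c T"
    using right[OF c] by blast
  obtain e' where e': "e' > 0" "\<And>s. s \<in> {T..<T + e'} \<Longrightarrow> c' s = c' T"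
    using right[OF c'] by blast
  have "T + min e e' \<le> s" if "s \<in> D" for s
  proof (rule ccontr)
    assume "\<not> T + min e e' \<le> s"
    moreover have "T \<le> s" using that D(2) by (auto simp: T_def intro: cInf_lower)
    ultimately have "c s = c' s" using e(2)[of s] e'(2)[of s] cT by auto
    then show False using that by (auto simp: D_def)
  qed
  then have "T + min e e' \<le> T"
    using D(1) by (subst (2) T_def) (auto intro: cInf_greatest)
  then show False using e e' by auto
qed

end

section \<open>Construction of a solution from step to step\<close>

context clock_system
begin

text \<open>The rates \<open>r c\<close> are not tied to \<open>v\<close>:
  \<open>changed_at_holding\<close> applies this to clocks that have already advanced but still run
  at their old rates.\<close>

lemma counters_unchanged_initially:
  assumes "\<And>k. 0 \<le> v k"
  shows "\<exists>e>0. \<forall>s k. 0 \<le> s \<longrightarrow> s < e \<longrightarrow> N k (v k + r c k * s) = N k (v k)"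
proof -
  obtain d where d: "d > 0" "\<And>k x. x \<in> {v k..<v k + d} \<Longrightarrow> N k x = N k (v k)"
    using N_right_constant_uniform[of v] assms by blast
  \<comment> \<open>The summand 1 keeps \<open>R\<close> positive when all rates vanish; before time
    \<open>d / R\<close> no clock advances by \<open>d\<close>.\<close>
  define R where "R = 1 + (\<Sum>k\<in>UNIV. r c k)"
  have R: "R > 0" "\<And>k. r c k \<le> R"
  proof -
    have "0 \<le> (\<Sum>k\<in>UNIV. r c k)" by (intro sum_nonneg) (auto simp: r_nonneg)
    then show "R > 0" by (simp add: R_def)
    fix k
    have "r c k \<le> (\<Sum>k\<in>UNIV. r c k)" by (intro member_le_sum) (auto simp: r_nonneg)
    then show "r c k \<le> R" by (simp add: R_def)
  qed
  have "N k (v k + r c k * s) = N k (v k)" if "0 \<le> s" "s < d / R" for s k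
  proof (rule d(2))
    have "r c k * s \<le> R * s" using R that by (intro mult_right_mono) auto
    also have "\<dots> < d" using that R by (simp add: field_simps)
    finally show "v k + r c k * s \<in> {v k..<v k + d}" using that by (auto simp: r_nonneg)
  qed
  moreover have "d / R > 0" using d R by simp
  ultimately show ?thesis by blast
qed

lemma holding_le: "holding N r u \<le> 1"
  unfolding holding_def by (rule cInf_lower) (auto intro: bdd_belowI[of _ 0])

lemma holding_greatest:
  assumes "e \<le> 1"
    and "\<And>s. 0 < s \<Longrightarrow> s < 1 \<Longrightarrow> s < e \<Longrightarrow> \<forall>k. N k (u k + r (counts N u) k * s) = N k (u k)"
  shows "e \<le> holding N r u"
  unfolding holding_def
proof (rule cInf_greatest)
  fix s assume s: "s \<in> insert 1 {s \<in> \<rat>. 0 < s \<and> s < 1 \<and> (\<exists>k. N k (u k + r (counts N u) k * s) \<noteq> N k (u k))}"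
  show "e \<le> s"
    using s assms(1) assms(2)[of s] by (cases "s < e") auto
qed simp

lemma holding_pos:
  assumes "\<And>k. 0 \<le> u k"
  shows "0 < holding N r u"
proof -
  obtain e where "e > 0" "\<And>s k. 0 \<le> s \<Longrightarrow> s < e \<Longrightarrow> N k (u k + r (counts N u) k * s) = N k (u k)"
    using counters_unchanged_initially[of u] assms by blast
  then have "min e 1 \<le> holding N r u" by (intro holding_greatest) auto
  with \<open>e > 0\<close> show ?thesis by simp
qed

text \<open>\<open>holding\<close> tests rational times only. A real \<open>s\<close> is squeezed
  between 0 and a rational \<open>q\<close> below the infimum, and monotone counters with equal
  values at both ends are constant in between.\<close>

lemma unchanged_before_holding:
  assumes u: "\<And>k. 0 \<le> u k" and s: "0 \<le> s" "s < holding N r u"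
  shows "N k (u k + r (counts N u) k * s) = N k (u k)"
proof -
  obtain q where q: "q \<in> \<rat>" "s < q" "q < holding N r u"
    using Rats_dense_in_real[OF s(2)] by blast
  have "q < 1" using q holding_le[of u] by simp
  have Nq: "N k (u k + r (counts N u) k * q) = N k (u k)"
  proof (rule ccontr)
    assume "N k (u k + r (counts N u) k * q) \<noteq> N k (u k)"
    then have "holding N r u \<le> q"
      unfolding holding_def using q s \<open>q < 1\<close>
      by (intro cInf_lower) (auto intro: bdd_belowI[of _ 0])
    with q show False by simp
  qed
  have rs: "0 \<le> r (counts N u) k * s" "r (counts N u) k * s \<le> r (counts N u) k * q"
    using s q by (auto simp: r_nonneg intro!: mult_left_mono)
  have "N k (u k) \<le> N k (u k + r (counts N u) k * s)"
    by (rule mono_onD[OF N_mono]) (use u[of k] rs in auto)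
  moreover have "N k (u k + r (counts N u) k * s) \<le> N k (u k + r (counts N u) k * q)"
    by (rule mono_onD[OF N_mono]) (use u[of k] rs in auto)
  ultimately show ?thesis using Nq by simp
qed

text \<open>The infimum is attained: if no counter had changed at the holding time, right-continuity
  would prolong the unchanged stretch beyond it. The bound by 1 rules out that the step ended by the
  cut-off.\<close>

lemma changed_at_holding:
  assumes u: "\<And>k. 0 \<le> u k" and "holding N r u < 1"
  shows "\<exists>k. N k (u k + r (counts N u) k * holding N r u) \<noteq> N k (u k)"
proof (rule ccontr)
  let ?c = "counts N u" and ?h = "holding N r u"
  assume "\<not> ?thesis"
  then have same: "N k (u k + r ?c k * ?h) = N k (u k)" for k by simp
  have "0 \<le> u k + r ?c k * ?h" for k
    using u[of k] holding_pos[of u] u by (simp add: r_nonneg less_imp_le)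
  then obtain e where e: "e > 0"
    "\<And>s k. 0 \<le> s \<Longrightarrow> s < e \<Longrightarrow> N k (u k + r ?c k * ?h + r ?c k * s) = N k (u k + r ?c k * ?h)"
    using counters_unchanged_initially[of "\<lambda>k. u k + r ?c k * ?h" ?c] by blast
  have "min (?h + e) 1 \<le> ?h"
  proof (rule holding_greatest)
    fix s assume s: "0 < s" "s < 1" "s < min (?h + e) 1"
    show "\<forall>k. N k (u k + r ?c k * s) = N k (u k)"
    proof
      fix k
      show "N k (u k + r ?c k * s) = N k (u k)"
      proof (cases "s < ?h")
        case True
        then show ?thesis using s by (intro unchanged_before_holding u) auto
      next
        case False
        have "u k + r ?c k * s = u k + r ?c k * ?h + r ?c k * (s - ?h)" by (simp add: algebra_simps)
        then show ?thesis using e(2)[of "s - ?h" k] False s same[of k] by (simp only:)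
      qed
    qed
  qed simp
  then show False using e(1) assms(2) by simp
qed

lemma clocks_nonneg: "0 \<le> clocks N r m k"
proof (induction m arbitrary: k)
  case (Suc m)
  have "0 < holding N r (clocks N r m)" by (rule holding_pos) (rule Suc)
  then show ?case using Suc[of k] by (simp add: r_nonneg)
qed simp

lemma holding_clocks_pos: "0 < holding N r (clocks N r m)"
  by (rule holding_pos) (rule clocks_nonneg)

lemma clocks_mono: "clocks N r m k \<le> clocks N r (Suc m) k"
  using holding_clocks_pos[of m] by (simp add: r_nonneg)

lemma counts_mono: "counts N (clocks N r m) k \<le> counts N (clocks N r (Suc m)) k"
  unfolding counts_def
  by (rule mono_onD[OF N_mono]) (use clocks_nonneg clocks_mono in \<open>auto simp del: clocks.simps\<close>)

lemma epoch_Suc: "epoch N r (Suc m) = epoch N r m + holding N r (clocks N r m)"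
  by (simp add: epoch_def)

lemma epoch_less: "epoch N r m < epoch N r (Suc m)"
  using holding_clocks_pos[of m] by (simp add: epoch_Suc)

lemma epoch_mono: "m \<le> m' \<Longrightarrow> epoch N r m \<le> epoch N r m'"
  by (rule lift_Suc_mono_le) (use epoch_less in \<open>auto intro: less_imp_le\<close>)

lemma epoch_nonneg: "0 \<le> epoch N r m"
  using epoch_mono[of 0 m] by (simp add: epoch_def)

lemma jump_path_between:
  assumes "epoch N r m \<le> t" "t < epoch N r (Suc m)"
  shows "jump_path N r t = counts N (clocks N r m)"
proof -
  have "(LEAST m. t < epoch N r (Suc m)) = m"
  proof (rule Least_equality)
    fix j assume "t < epoch N r (Suc j)"
    with assms(1) have "epoch N r m < epoch N r (Suc j)" by simp
    then have "\<not> Suc j \<le> m" using epoch_mono[of "Suc j" m] by linarith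
    then show "m \<le> j" by simp
  qed (rule assms)
  then show ?thesis by (simp add: jump_path_def)
qed

text \<open>The half-open interval keeps the formula valid at \<open>t = epoch N r (Suc m)\<close>,
  where the path already has its next value; there it yields \<open>clocks N r (Suc m) k\<close>,
  from which the next step starts.\<close>

lemma clock_integral:
  assumes "epoch N r m \<le> t" "t \<le> epoch N r (Suc m)"
  shows "set_integrable lborel {0..<t} (\<lambda>s. r (jump_path N r s) k) \<and>
    (LBINT s:{0..<t}. r (jump_path N r s) k) =
      clocks N r m k + r (counts N (clocks N r m)) k * (t - epoch N r m)"
  using assms
proof (induction m arbitrary: t)
  case 0
  have const: "r (jump_path N r s) k = r (counts N (clocks N r 0)) k" if "0 \<le> s" "s < t" for s
    using jump_path_between[of 0 s] that 0 by (simp add: epoch_def)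
  have t: "0 \<le> t" using 0 by (simp add: epoch_def)
  show ?case
    using set_lborel_integral_const_on[OF t const] by (simp add: epoch_def)
next
  case (Suc m)
  let ?T = "epoch N r (Suc m)" and ?f = "\<lambda>s. r (jump_path N r s) k"
  have IH: "set_integrable lborel {0..<?T} ?f" "(LBINT s:{0..<?T}. ?f s) = clocks N r (Suc m) k"
    using Suc.IH[of ?T] epoch_less[of m] by (auto simp: epoch_Suc)
  have const: "?f s = r (counts N (clocks N r (Suc m))) k" if "?T \<le> s" "s < t" for s
    using jump_path_between[of "Suc m" s] that Suc.prems by (simp del: clocks.simps)
  note piece = set_lborel_integral_const_on[OF Suc.prems(1) const]
  have split: "{0..<t} = {0..<?T} \<union> {?T..<t}"
    using Suc.prems(1) epoch_nonneg[of "Suc m"] by auto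
  have "set_integrable lborel {0..<t} ?f"
    unfolding split by (rule set_integrable_Un) (use IH piece in auto)
  moreover have "(LBINT s:{0..<t}. ?f s) = (LBINT s:{0..<?T}. ?f s) + (LBINT s:{?T..<t}. ?f s)"
    unfolding split by (rule set_integral_Un) (use IH piece in auto)
  ultimately show ?case by (simp only: IH piece simp_thms)
qed

theorem clock_solution_jump_path:
  assumes unbounded: "\<And>t. \<exists>m. t < epoch N r m"
  shows "clock_solution N r (jump_path N r)"
  unfolding clock_solution_def
proof (intro allI impI)
  fix t :: real and k assume "0 \<le> t"
  define m where "m = (LEAST m. t < epoch N r (Suc m))"
  obtain m' where "t < epoch N r m'" using unbounded by blast
  then have "t < epoch N r (Suc m')" using epoch_less[of m'] by simp
  then have m: "t < epoch N r (Suc m)" unfolding m_def by (rule LeastI)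
  have m': "epoch N r m \<le> t"
  proof (cases m)
    case 0
    then show ?thesis using \<open>0 \<le> t\<close> by (simp add: epoch_def)
  next
    case (Suc j)
    then have "\<not> t < epoch N r (Suc j)" unfolding m_def by (intro not_less_Least) simp
    with Suc show ?thesis by simp
  qed
  let ?f = "\<lambda>s. r (jump_path N r s) k"
  have I: "set_integrable lborel {0..<t} ?f" "(LBINT s:{0..<t}. ?f s) =
      clocks N r m k + r (counts N (clocks N r m)) k * (t - epoch N r m)"
    using clock_integral[of m t k] m m' by auto
  have "jump_path N r t k = N k (clocks N r m k)"
    using jump_path_between[OF m' m] by (simp add: counts_def)
  also have "\<dots> = N k (clocks N r m k + r (counts N (clocks N r m)) k * (t - epoch N r m))"
    by (rule unchanged_before_holding[symmetric]) (use clocks_nonneg m m' in \<open>auto simp: epoch_Suc\<close>)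
  finally show "set_integrable lborel {0..t} ?f \<and> jump_path N r t k = N k (LBINT s:{0..t}. ?f s)"
    using set_lborel_integral_closed[OF \<open>0 \<le> t\<close> I(1)] I(2) by simp
qed

section \<open>Non-explosion\<close>

text \<open>Every step takes unit time or increases some counter.\<close>

lemma step_number_le: "real m \<le> epoch N r m + (\<Sum>k\<in>UNIV. real (counts N (clocks N r m) k))"
proof (induction m)
  case (Suc m)
  let ?u = "clocks N r m" and ?u' = "clocks N r (Suc m)"
  have le: "real (counts N ?u k) \<le> real (counts N ?u' k)" for k
    using counts_mono by (simp del: clocks.simps)
  show ?case
  proof (cases "holding N r ?u < 1")
    case True
    then obtain k where "counts N ?u' k \<noteq> counts N ?u k"
      using changed_at_holding[of ?u] clocks_nonneg by (auto simp: counts_def)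
    then have k: "real (counts N ?u k) + 1 \<le> real (counts N ?u' k)"
      using counts_mono[of m k] by (simp del: clocks.simps)
    have "(\<Sum>k\<in>UNIV. real (counts N ?u k)) + 1
        = (\<Sum>j\<in>UNIV. real (counts N ?u j) + (if j = k then 1 else 0))"
      by (simp add: sum.distrib)
    also have "\<dots> \<le> (\<Sum>j\<in>UNIV. real (counts N ?u' j))"
      by (rule sum_mono) (use k le in auto)
    finally show ?thesis using Suc epoch_less[of m] by simp
  next
    case False
    then have "epoch N r (Suc m) = epoch N r m + 1"
      using holding_le[of ?u] by (simp add: epoch_Suc)
    moreover have "(\<Sum>k\<in>UNIV. real (counts N ?u k)) \<le> (\<Sum>k\<in>UNIV. real (counts N ?u' k))"
      by (rule sum_mono) (rule le)
    ultimately show ?thesis using Suc by simp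
  qed
qed (simp add: epoch_def sum_nonneg)

text \<open>A discrete Gronwall argument: if the epochs stayed below \<open>t\<close>, the clocks and hence the
  counters would stay bounded, although there are infinitely many steps.\<close>

theorem epochs_unbounded:
  assumes growth: "\<And>m. (\<Sum>k\<in>UNIV. r (counts N (clocks N r m)) k) \<le> C * (1 + (\<Sum>k\<in>UNIV. clocks N r m k))"
  shows "\<exists>m. t < epoch N r m"
proof (rule ccontr)
  assume "\<not> ?thesis"
  then have bounded: "epoch N r m \<le> t" for m by (simp add: not_less)
  define U where "U m = (\<Sum>k\<in>UNIV. clocks N r m k)" for m
  have U: "0 \<le> U m" for m unfolding U_def by (intro sum_nonneg clocks_nonneg)
  \<comment> \<open>All clocks vanish at step 0, so \<open>growth\<close> bounds a nonnegative sum
    by \<open>C\<close> there.\<close>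
  have "0 \<le> (\<Sum>k\<in>UNIV. r (counts N (clocks N r 0)) k)" by (intro sum_nonneg r_nonneg)
  with growth[of 0] have C: "0 \<le> C" by simp
  have exp: "1 + U m \<le> exp (C * epoch N r m)" for m
  proof (induction m)
    case (Suc m)
    let ?h = "holding N r (clocks N r m)"
    have h: "0 \<le> ?h" using holding_clocks_pos[of m] by simp
    have "1 + U (Suc m) = 1 + U m + (\<Sum>k\<in>UNIV. r (counts N (clocks N r m)) k) * ?h"
      by (simp add: U_def sum.distrib sum_distrib_right)
    also have "\<dots> \<le> 1 + U m + C * (1 + U m) * ?h"
      using mult_right_mono[OF growth h] by (simp add: U_def)
    also have "\<dots> = (1 + U m) * (1 + C * ?h)" by (simp add: algebra_simps)
    also have "\<dots> \<le> exp (C * epoch N r m) * exp (C * ?h)"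
      by (rule mult_mono) (use Suc U[of m] C h in \<open>auto intro: exp_ge_add_one_self\<close>)
    also have "\<dots> = exp (C * epoch N r (Suc m))"
      by (simp add: epoch_Suc exp_add[symmetric] algebra_simps)
    finally show ?case .
  qed (simp add: U_def epoch_def)
  define B where "B = exp (C * t)"
  have UB: "U m \<le> B" for m
  proof -
    have "exp (C * epoch N r m) \<le> B"
      unfolding B_def using bounded C by (simp add: mult_left_mono)
    then show ?thesis using exp[of m] by simp
  qed
  have cB: "clocks N r m k \<le> B" for m k
  proof -
    have "clocks N r m k \<le> U m"
      unfolding U_def by (intro member_le_sum) (auto simp: clocks_nonneg)
    with UB[of m] show ?thesis by simp
  qed
  have "real m \<le> t + (\<Sum>k\<in>UNIV. real (N k B))" for m
  proof -
    have "real (counts N (clocks N r m) k) \<le> real (N k B)" for k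
      unfolding counts_def of_nat_le_iff
      by (rule mono_onD[OF N_mono]) (use clocks_nonneg[of m k] cB[of m k] in auto)
    then have "(\<Sum>k\<in>UNIV. real (counts N (clocks N r m) k)) \<le> (\<Sum>k\<in>UNIV. real (N k B))"
      by (intro sum_mono)
    with step_number_le[of m] bounded[of m] show ?thesis by simp
  qed
  then show False using reals_Archimedean2 not_less by blast
qed

end

section \<open>Measurable dependence on the data\<close>

lemma holding_nonneg: "0 \<le> holding N r u"
  unfolding holding_def by (rule cInf_greatest) auto

lemma clocks_nonneg_of_rates:
  assumes "\<And>c k. 0 \<le> r c k"
  shows "0 \<le> clocks N r m k"
  by (induction m) (auto simp: assms holding_nonneg)

text \<open>Quantifying over the countable type \<open>rat\<close> turns the event that the infimum
  lies below \<open>x\<close> into a countable union of measurable events.\<close>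

lemma holding_less_iff:
  "holding N r u < x \<longleftrightarrow> 1 < x \<or>
    (\<exists>q::rat. 0 < q \<and> q < 1 \<and> of_rat q < x \<and>
       (\<exists>k. N k (u k + r (counts N u) k * of_rat q) \<noteq> N k (u k)))"
proof -
  define Q where "Q s \<longleftrightarrow> (\<exists>k. N k (u k + r (counts N u) k * s) \<noteq> N k (u k))" for s
  have "holding N r u < x \<longleftrightarrow> (\<exists>s\<in>insert 1 {s \<in> \<rat>. 0 < s \<and> s < 1 \<and> Q s}. s < x)"
    unfolding holding_def Q_def by (rule cInf_less_iff) (auto intro: bdd_belowI[of _ 0])
  also have "\<dots> \<longleftrightarrow> 1 < x \<or> (\<exists>s\<in>\<rat>. 0 < s \<and> s < 1 \<and> s < x \<and> Q s)"
    by blast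
  also have "\<dots> \<longleftrightarrow> 1 < x \<or> (\<exists>q::rat. 0 < q \<and> q < 1 \<and> of_rat q < x \<and> Q (of_rat q))"
    by (simp add: Rats_def)
  finally show ?thesis by (simp only: Q_def)
qed

text \<open>Nothing about monotone or right-continuous counters is demanded here, so that the locale
  can be interpreted on the whole of \<open>primitive_space\<close>.\<close>

locale measurable_clock_data =
  fixes P :: "'p measure" and N :: "'p \<Rightarrow> 'c::finite \<Rightarrow> real \<Rightarrow> nat"
    and r :: "'p \<Rightarrow> ('c \<Rightarrow> nat) \<Rightarrow> 'c \<Rightarrow> real"
  assumes measurable_counter: "\<And>v k. v \<in> borel_measurable P \<Longrightarrow> (\<And>p. p \<in> space P \<Longrightarrow> 0 \<le> v p) \<Longrightarrow>
      (\<lambda>p. N p k (v p)) \<in> measurable P (count_space UNIV)"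
    and measurable_rate: "\<And>c k. (\<lambda>p. r p c k) \<in> borel_measurable P"
    and rate_nonneg: "\<And>p c k. p \<in> space P \<Longrightarrow> 0 \<le> r p c k"
begin

text \<open>As \<open>'c\<close> is finite, the type of count vectors is countable and preimages of
  single vectors suffice. This countability also lets rates be evaluated at random counts
  below.\<close>

lemma measurable_counts:
  assumes "\<And>k. (\<lambda>p. u p k) \<in> borel_measurable P" "\<And>p k. p \<in> space P \<Longrightarrow> 0 \<le> u p k"
  shows "(\<lambda>p. counts (N p) (u p)) \<in> measurable P (count_space UNIV)"
proof (subst measurable_count_space_eq2_countable, intro conjI ballI)
  have [measurable]: "(\<lambda>p. N p k (u p k)) \<in> measurable P (count_space UNIV)" for k
    using assms by (intro measurable_counter)
  fix c :: "'c \<Rightarrow> nat"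
  have "(\<lambda>p. counts (N p) (u p)) -` {c} \<inter> space P = {p \<in> space P. \<forall>k. N p k (u p k) = c k}"
    by (auto simp: counts_def fun_eq_iff)
  also have "\<dots> \<in> sets P" by measurable
  finally show "(\<lambda>p. counts (N p) (u p)) -` {c} \<inter> space P \<in> sets P" .
qed auto

lemma measurable_rate_counts:
  assumes "\<And>k. (\<lambda>p. u p k) \<in> borel_measurable P" "\<And>p k. p \<in> space P \<Longrightarrow> 0 \<le> u p k"
  shows "(\<lambda>p. r p (counts (N p) (u p)) k) \<in> borel_measurable P"
  by (rule measurable_compose_countable[OF measurable_rate measurable_counts, of u]) (rule assms)+

lemma measurable_holding:
  assumes u: "\<And>k. (\<lambda>p. u p k) \<in> borel_measurable P" "\<And>p k. p \<in> space P \<Longrightarrow> 0 \<le> u p k"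
  shows "(\<lambda>p. holding (N p) (r p) (u p)) \<in> borel_measurable P"
proof (rule borel_measurableI_less)
  fix x :: real
  note [measurable] = u(1) measurable_rate_counts[of u, OF u]
  have [measurable]: "(\<lambda>p. N p k (u p k)) \<in> measurable P (count_space UNIV)" for k
    using u by (intro measurable_counter)
  define E where "E q k = {p \<in> space P.
      N p k (u p k + r p (counts (N p) (u p)) k * of_rat q) \<noteq> N p k (u p k)}" for q k
  have "E q k \<in> sets P" if "0 < q" for q k
  proof -
    have [measurable]: "(\<lambda>p. N p k (u p k + r p (counts (N p) (u p)) k * of_rat q))
        \<in> measurable P (count_space UNIV)"
      using that u(2) rate_nonneg by (intro measurable_counter) auto
    have "E q k = {p \<in> space P. \<exists>i. N p k (u p k + r p (counts (N p) (u p)) k * of_rat q) = i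
        \<and> N p k (u p k) \<noteq> i}"
      by (auto simp: E_def)
    also have "\<dots> \<in> sets P" by measurable
    finally show ?thesis .
  qed
  then have "(\<Union>q\<in>{q::rat. 0 < q \<and> q < 1 \<and> of_rat q < x}. \<Union>k. E q k) \<in> sets P"
    by (intro sets.countable_UN' sets.finite_UN) auto
  moreover have "{p \<in> space P. holding (N p) (r p) (u p) < x} =
      (if 1 < x then space P else (\<Union>q\<in>{q::rat. 0 < q \<and> q < 1 \<and> of_rat q < x}. \<Union>k. E q k))"
    by (auto simp: holding_less_iff E_def)
  ultimately show "{p \<in> space P. holding (N p) (r p) (u p) < x} \<in> sets P" by simp
qed

lemma measurable_clocks: "(\<lambda>p. clocks (N p) (r p) m k) \<in> borel_measurable P"
proof (induction m arbitrary: k)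
  case (Suc m)
  have nonneg: "0 \<le> clocks (N p) (r p) m k" if "p \<in> space P" for p k
    using rate_nonneg[OF that] by (rule clocks_nonneg_of_rates)
  note [measurable] = Suc measurable_holding[of "\<lambda>p. clocks (N p) (r p) m", OF Suc nonneg]
    measurable_rate_counts[of "\<lambda>p. clocks (N p) (r p) m", OF Suc nonneg]
  show ?case by simp
qed simp

lemma clocks_space_nonneg: "p \<in> space P \<Longrightarrow> 0 \<le> clocks (N p) (r p) m k"
  using rate_nonneg by (rule clocks_nonneg_of_rates)

lemma measurable_epoch: "(\<lambda>p. epoch (N p) (r p) m) \<in> borel_measurable P"
  unfolding epoch_def
  by (intro borel_measurable_sum measurable_holding measurable_clocks clocks_space_nonneg)

lemma measurable_jump_path:
  "(\<lambda>p. jump_path (N p) (r p) t) \<in> measurable P (count_space UNIV)"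
  unfolding jump_path_def
proof (rule measurable_compose_countable[where f="\<lambda>m p. counts (N p) (clocks (N p) (r p) m)"])
  show "(\<lambda>p. counts (N p) (clocks (N p) (r p) m)) \<in> measurable P (count_space UNIV)" for m
    by (intro measurable_counts measurable_clocks clocks_space_nonneg)
  note [measurable] = measurable_epoch
  show "(\<lambda>p. LEAST m. t < epoch (N p) (r p) (Suc m)) \<in> measurable P (count_space UNIV)"
    by measurable
qed

end

text \<open>The sigma-algebra of \<open>skorohod_space\<close> only knows evaluations at fixed
  times. A random time is approximated from the right by times with values in a grid, where only
  countably many fixed evaluations occur, and right-continuity passes to the limit.\<close>

lemma measurable_skorohod_eval:
  assumes f: "f \<in> measurable P skorohod_space" and v: "v \<in> borel_measurable P"
    and nonneg: "\<And>p. p \<in> space P \<Longrightarrow> 0 \<le> v p"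
  shows "(\<lambda>p. f p (v p)) \<in> borel_measurable P"
proof -
  have fP: "f \<in> measurable P (PiM {0..} (\<lambda>_. borel))" and fc: "\<And>p. p \<in> space P \<Longrightarrow> cadlag (f p)"
    using f unfolding skorohod_space_def measurable_restrict_space2_iff by auto
  \<comment> \<open>Adding 1 after rounding down puts the grid point strictly to the right of
    \<open>v p\<close>, as convergence along \<open>at_right\<close> requires.\<close>
  define w where "w j p = (real (nat \<lfloor>v p * Suc j\<rfloor>) + 1) / Suc j" for j p
  have "(\<lambda>p. f p (w j p)) \<in> borel_measurable P" for j
    unfolding w_def
  proof (rule measurable_compose_countable[where f="\<lambda>i p. f p ((real i + 1) / Suc j)"])
    show "(\<lambda>p. f p ((real i + 1) / Suc j)) \<in> borel_measurable P" for i
      by (rule measurable_compose[OF fP measurable_component_singleton]) simp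
    show "(\<lambda>p. nat \<lfloor>v p * Suc j\<rfloor>) \<in> measurable P (count_space UNIV)"
      using v by measurable
  qed
  moreover have "(\<lambda>j. f p (w j p)) \<longlonglongrightarrow> f p (v p)" if p: "p \<in> space P" for p
  proof -
    have w: "v p < w j p" "w j p \<le> v p + 1 / Suc j" for j
    proof -
      have "real (nat \<lfloor>v p * Suc j\<rfloor>) = of_int \<lfloor>v p * Suc j\<rfloor>"
        using nonneg[OF p] by simp
      then have eq: "w j p = (of_int \<lfloor>v p * Suc j\<rfloor> + 1) / Suc j" by (simp add: w_def)
      have "v p * Suc j < of_int \<lfloor>v p * Suc j\<rfloor> + 1" by (rule floor_correct[THEN conjunct2, simplified])
      then show "v p < w j p" unfolding eq by (simp add: pos_less_divide_eq del: of_nat_Suc)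
      have "of_int \<lfloor>v p * Suc j\<rfloor> \<le> v p * Suc j" by (rule of_int_floor_le)
      then show "w j p \<le> v p + 1 / Suc j"
        unfolding eq by (simp add: add_divide_distrib pos_divide_le_eq del: of_nat_Suc)
    qed
    have "(\<lambda>j. w j p) \<longlonglongrightarrow> v p"
    proof (rule tendsto_sandwich[where f="\<lambda>_. v p" and h="\<lambda>j. v p + 1 / Suc j"])
      show "(\<lambda>j. v p + 1 / Suc j) \<longlonglongrightarrow> v p"
        using tendsto_add[OF tendsto_const[of "v p"] LIMSEQ_Suc[OF lim_1_over_n]] by simp
    qed (use w in \<open>auto intro!: always_eventually less_imp_le simp del: of_nat_Suc\<close>)
    then have "filterlim (\<lambda>j. w j p) (at_right (v p)) sequentially"
      using w(1) by (auto simp: filterlim_at intro!: always_eventually less_imp_neq[symmetric])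
    moreover have "(f p \<longlongrightarrow> f p (v p)) (at_right (v p))"
      using fc[OF p] nonneg[OF p] by (simp add: cadlag_def)
    ultimately show ?thesis by (rule filterlim_compose[rotated])
  qed
  ultimately show ?thesis by (rule borel_measurable_LIMSEQ_real[rotated])
qed

lemma holding_cong:
  assumes N: "\<And>k v. 0 \<le> v \<Longrightarrow> N k v = N' k v" and u: "\<And>k. 0 \<le> u k" and r: "\<And>c k. 0 \<le> r c k"
  shows "holding N r u = holding N' r u"
proof -
  have c: "counts N u = counts N' u" using N u by (simp add: counts_def fun_eq_iff)
  have "N k (u k + r (counts N' u) k * s) = N' k (u k + r (counts N' u) k * s)" if "0 < s" for k s
    using N u[of k] r that by simp
  then show ?thesis
    unfolding holding_def c using N u
    by (intro arg_cong[of _ _ Inf] arg_cong2[of _ _ _ _ insert] refl Collect_cong conj_cong) auto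
qed

text \<open>The clocks start at 0 and never decrease, so counters are never read at negative times.
  This matters because \<open>primitive_element\<close> cuts the paths down to
  \<open>{0..}\<close>.\<close>

lemma jump_path_cong:
  assumes N: "\<And>k v. 0 \<le> v \<Longrightarrow> N k v = N' k v" and r: "\<And>c k. 0 \<le> r c k"
  shows "jump_path N r t = jump_path N' r t"
proof -
  have counts: "counts N u = counts N' u" if "\<And>k. 0 \<le> u k" for u
    using N that by (simp add: counts_def fun_eq_iff)
  note nonneg = clocks_nonneg_of_rates[of r, OF r]
  have clocks: "clocks N r m = clocks N' r m" for m
  proof (induction m)
    case (Suc m)
    then show ?case
      using counts[of "clocks N' r m"] holding_cong[of N N' "clocks N' r m" r] N r nonneg by simp
  qed simp
  have "epoch N r m = epoch N' r m" for m
    unfolding epoch_def clocks by (intro sum.cong refl holding_cong N nonneg r)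
  then show ?thesis
    unfolding jump_path_def clocks by (intro counts nonneg | simp)+
qed

text \<open>The cut at 0 stays invisible: \<open>cadlag\<close> asks for left limits at positive
  times only.\<close>

lemma cadlag_restrict:
  assumes "cadlag f"
  shows "cadlag (\<lambda>t\<in>{0..}. f t)"
  unfolding cadlag_def
proof (intro conjI allI impI)
  fix t :: real
  {
    assume t: "0 \<le> t"
    have "eventually (\<lambda>s. s > t) (at_right t)" by (simp add: eventually_at_filter)
    then have "eventually (\<lambda>s. f s = (\<lambda>t\<in>{0..}. f t) s) (at_right t)"
      by eventually_elim (use t in auto)
    moreover have "(f \<longlongrightarrow> f t) (at_right t)" using assms t by (simp add: cadlag_def)
    ultimately have "((\<lambda>t\<in>{0..}. f t) \<longlongrightarrow> f t) (at_right t)"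
      by (rule Lim_transform_eventually[rotated])
    then show "((\<lambda>t\<in>{0..}. f t) \<longlongrightarrow> (\<lambda>t\<in>{0..}. f t) t) (at_right t)"
      using t by simp
  }
  assume t: "0 < t"
  then obtain l where l: "(f \<longlongrightarrow> l) (at_left t)" using assms by (auto simp: cadlag_def)
  have "eventually (\<lambda>s. s \<in> {0<..<t}) (at_left t)" using t by (rule eventually_at_left_real)
  then have "eventually (\<lambda>s. f s = (\<lambda>t\<in>{0..}. f t) s) (at_left t)"
    by eventually_elim auto
  with l show "\<exists>l. ((\<lambda>t\<in>{0..}. f t) \<longlongrightarrow> l) (at_left t)"
    by (blast intro: Lim_transform_eventually)
qed

section \<open>The network as a system of clocks\<close>

text \<open>The counters \<open>Inl i\<close> count the exogenous arrivals at station \<open>i\<close>, the counters \<open>Inr i\<close> the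
  departures from it; together they determine the queue lengths.\<close>

definition net_balance ::
    "nat ^ 'k::finite \<Rightarrow> ('k \<Rightarrow> 'k \<Rightarrow> nat \<Rightarrow> nat) \<Rightarrow> ('k + 'k \<Rightarrow> nat) \<Rightarrow> 'k \<Rightarrow> int" where
  "net_balance q0 phi c i =
     int (q0 $ i) + int (c (Inl i)) + (\<Sum>j\<in>UNIV. int (phi j i (c (Inr j)))) - int (c (Inr i))"

text \<open>The truncation by \<open>nat\<close> assigns a state, and hence rates, to count vectors
  with negative balances too.\<close>

definition net_state ::
    "nat ^ 'k::finite \<Rightarrow> ('k \<Rightarrow> 'k \<Rightarrow> nat \<Rightarrow> nat) \<Rightarrow> ('k + 'k \<Rightarrow> nat) \<Rightarrow> nat ^ 'k" where
  "net_state q0 phi c = (\<chi> i. nat (net_balance q0 phi c i))"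

definition service_rates ::
    "('k::finite \<Rightarrow> real ^ 'k \<Rightarrow> real) \<Rightarrow> ('k \<Rightarrow> real ^ 'k \<Rightarrow> real) \<Rightarrow> nat ^ 'k \<Rightarrow> 'k + 'k \<Rightarrow> real" where
  "service_rates lam mu q =
     case_sum (\<lambda>i. lam i (real_vec q)) (\<lambda>i. mu i (real_vec q) * of_bool (q $ i > 0))"

definition net_rate ::
    "('k::finite \<Rightarrow> real ^ 'k \<Rightarrow> real) \<Rightarrow> ('k \<Rightarrow> real ^ 'k \<Rightarrow> real) \<Rightarrow> nat ^ 'k \<Rightarrow>
      ('k \<Rightarrow> 'k \<Rightarrow> nat \<Rightarrow> nat) \<Rightarrow> ('k + 'k \<Rightarrow> nat) \<Rightarrow> 'k + 'k \<Rightarrow> real" where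
  "net_rate lam mu q0 phi c = service_rates lam mu (net_state q0 phi c)"

lemma real_vec_orthant: "real_vec q \<in> orthant"
  by (simp add: real_vec_def orthant_def)

lemma service_rates_nonneg:
  assumes "\<And>i x. x \<in> orthant \<Longrightarrow> 0 \<le> lam i x" "\<And>i x. x \<in> orthant \<Longrightarrow> 0 \<le> mu i x"
  shows "0 \<le> service_rates lam mu q k"
  by (cases k) (auto simp: service_rates_def assms real_vec_orthant)

lemma network_equations_iff:
  "network_equations lam mu q0 na nd phi q \<longleftrightarrow>
     (\<forall>t\<ge>0. (\<forall>k. set_integrable lborel {0..t} (\<lambda>s. service_rates lam mu (q s) k)) \<and>
       (\<forall>i. int (q t $ i) = net_balance q0 phi
          (\<lambda>k. case_sum na nd k (LBINT s:{0..t}. service_rates lam mu (q s) k)) i))"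
proof -
  have eq: "real a = real b + real c + real d - real e \<longleftrightarrow> int a = int b + int c + int d - int e"
    for a b c d e :: nat by linarith
  show ?thesis
    unfolding network_equations_def exo_arrivals_def endo_arrivals_def departures_def
      net_balance_def service_rates_def indicator_def eq
    by (simp add: split_sum_all) blast
qed

text \<open>In a solution each balance equals a queue length, hence is nonnegative, and
  \<open>net_state\<close> recovers the queue exactly. The speeds thus depend on the counters
  alone.\<close>

lemma clock_solution_of_network_equations:
  assumes "network_equations lam mu q0 na nd phi q"
  shows "\<exists>c. clock_solution (case_sum na nd) (net_rate lam mu q0 phi) c \<and>
    (\<forall>t\<ge>0. q t = net_state q0 phi (c t))"
proof -
  define c where "c t k = case_sum na nd k (LBINT s:{0..t}. service_rates lam mu (q s) k)" for t k
  have int: "set_integrable lborel {0..t} (\<lambda>s. service_rates lam mu (q s) k)"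
    and q: "int (q t $ i) = net_balance q0 phi (c t) i" if "0 \<le> t" for t k i
    using assms that unfolding network_equations_iff c_def by blast+
  have state: "q t = net_state q0 phi (c t)" if "0 \<le> t" for t
    by (simp add: vec_eq_iff net_state_def q[OF that, symmetric])
  have rate: "net_rate lam mu q0 phi (c s) k = service_rates lam mu (q s) k" if "0 \<le> s" for s k
    using state[OF that] by (simp add: net_rate_def)
  have "clock_solution (case_sum na nd) (net_rate lam mu q0 phi) c"
    unfolding clock_solution_def
  proof (intro allI impI)
    fix t :: real and k assume t: "0 \<le> t"
    have "set_integrable lborel {0..t} (\<lambda>s. net_rate lam mu q0 phi (c s) k) \<longleftrightarrow>
        set_integrable lborel {0..t} (\<lambda>s. service_rates lam mu (q s) k)"
      by (rule set_integrable_cong) (auto simp: rate)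
    moreover have "(LBINT s:{0..t}. net_rate lam mu q0 phi (c s) k) =
        (LBINT s:{0..t}. service_rates lam mu (q s) k)"
      by (rule set_lebesgue_integral_cong) (auto simp: rate)
    ultimately show "set_integrable lborel {0..t} (\<lambda>s. net_rate lam mu q0 phi (c s) k) \<and>
        c t k = case_sum na nd k (LBINT s:{0..t}. net_rate lam mu q0 phi (c s) k)"
      using int[OF t] by (simp add: c_def)
  qed
  with state show ?thesis by blast
qed

text \<open>Here nonnegative balances have to be supplied: a truncated balance would violate the
  balance equation.\<close>

lemma network_equations_of_clock_solution:
  assumes c: "clock_solution (case_sum na nd) (net_rate lam mu q0 phi) c"
    and nonneg: "\<And>t i. 0 \<le> t \<Longrightarrow> 0 \<le> net_balance q0 phi (c t) i"
    and q: "\<And>t. 0 \<le> t \<Longrightarrow> q t = net_state q0 phi (c t)"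
  shows "network_equations lam mu q0 na nd phi q"
  unfolding network_equations_iff
proof (intro allI impI conjI)
  fix t :: real assume t: "0 \<le> t"
  have rate: "service_rates lam mu (q s) k = net_rate lam mu q0 phi (c s) k" if "0 \<le> s" for s k
    using q[OF that] by (simp add: net_rate_def)
  have "set_integrable lborel {0..t} (\<lambda>s. service_rates lam mu (q s) k) \<longleftrightarrow>
      set_integrable lborel {0..t} (\<lambda>s. net_rate lam mu q0 phi (c s) k)" for k
    by (rule set_integrable_cong) (auto simp: rate)
  then show "set_integrable lborel {0..t} (\<lambda>s. service_rates lam mu (q s) k)" for k
    using c t by (simp add: clock_solution_def)
  have "(LBINT s:{0..t}. service_rates lam mu (q s) k) =
      (LBINT s:{0..t}. net_rate lam mu q0 phi (c s) k)" for k
    by (rule set_lebesgue_integral_cong) (auto simp: rate)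
  then have "c t = (\<lambda>k. case_sum na nd k (LBINT s:{0..t}. service_rates lam mu (q s) k))"
    using c t by (simp add: clock_solution_def fun_eq_iff)
  then show "int (q t $ i) = net_balance q0 phi
      (\<lambda>k. case_sum na nd k (LBINT s:{0..t}. service_rates lam mu (q s) k)) i" for i
    using nonneg[OF t, of i] q[OF t] by (simp add: net_state_def)
qed

section \<open>A fixed path of the primitives: nonnegative queues and growth of the rates\<close>

locale network_path =
  fixes lam mu :: "'k::finite \<Rightarrow> real ^ 'k \<Rightarrow> real" and q0 :: "nat ^ 'k"
    and na nd :: "'k \<Rightarrow> real \<Rightarrow> nat" and phi :: "'k \<Rightarrow> 'k \<Rightarrow> nat \<Rightarrow> nat"
  assumes lam_nonneg: "\<And>i x. x \<in> orthant \<Longrightarrow> 0 \<le> lam i x"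
    and mu_nonneg: "\<And>i x. x \<in> orthant \<Longrightarrow> 0 \<le> mu i x"
    and na_mono: "\<And>i. mono_on {0..} (na i)"
    and na_cadlag: "\<And>i. cadlag (\<lambda>t. real (na i t))"
    and nd_0: "\<And>i. nd i 0 = 0"
    and nd_mono: "\<And>i. mono_on {0..} (nd i)"
    and nd_cadlag: "\<And>i. cadlag (\<lambda>t. real (nd i t))"
    and nd_jumps: "\<And>i t. 0 < t \<Longrightarrow> real (nd i t) - Lim (at_left t) (\<lambda>s. real (nd i s)) \<le> 1"
    and phi_0: "\<And>i j. phi i j 0 = 0"
    and phi_increment: "\<And>i j m. int (phi i j (Suc m)) - int (phi i j m) \<in> {0, 1}"
    and phi_route: "\<And>i m. (\<Sum>j\<in>UNIV. int (phi i j (Suc m)) - int (phi i j m)) \<le> 1"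
begin

abbreviation "N \<equiv> case_sum na nd"
abbreviation "r \<equiv> net_rate lam mu q0 phi"
abbreviation "balance \<equiv> net_balance q0 phi"

sublocale clock_system N r
proof
  show "mono_on {0..} (N k)" for k
    using na_mono nd_mono by (cases k) auto
  show "\<exists>d>0. \<forall>x\<in>{a..<a + d}. N k x = N k a" if "0 \<le> a" for k a
    using cadlag_nat_right_constant[OF na_cadlag that] cadlag_nat_right_constant[OF nd_cadlag that]
    by (cases k) auto
  show "0 \<le> r c k" for c k
    unfolding net_rate_def by (rule service_rates_nonneg[OF lam_nonneg mu_nonneg])
qed

lemma phi_mono: "m \<le> m' \<Longrightarrow> phi i j m \<le> phi i j m'"
proof (rule lift_Suc_mono_le[of "phi i j"])
  show "phi i j m \<le> phi i j (Suc m)" for m using phi_increment[of i j m] by auto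
qed auto

text \<open>Each departing customer is routed to at most one station.\<close>

lemma phi_sum_le: "(\<Sum>j\<in>UNIV. int (phi i j m)) \<le> int m"
proof (induction m)
  case (Suc m)
  then show ?case using phi_route[of i m] by (simp add: sum_subtractf)
qed (simp add: phi_0)

text \<open>During a step the counter keeps its old value up to the end of the step, so this value
  is the left limit there and \<open>nd_jumps\<close> bounds the increment. A clock of rate 0 does
  not move at all.\<close>

lemma departures_step:
  "nd i (clocks N r (Suc m) (Inr i)) \<le> nd i (clocks N r m (Inr i)) + 1"
proof (cases "r (counts N (clocks N r m)) (Inr i) = 0")
  case False
  let ?u = "clocks N r m" and ?h = "holding N r (clocks N r m)"
  let ?\<rho> = "r (counts N ?u) (Inr i)"
  let ?a = "?u (Inr i) + ?\<rho> * ?h"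
  have rho: "0 < ?\<rho>" using False r_nonneg[of "counts N ?u" "Inr i"] by simp
  have h: "0 < ?h" by (rule holding_clocks_pos)
  have less: "?u (Inr i) < ?a" using rho h by simp
  have a: "0 < ?a" using less clocks_nonneg[of m "Inr i"] by linarith
  have const: "nd i s = nd i (?u (Inr i))" if "?u (Inr i) < s" "s < ?a" for s
  proof -
    \<comment> \<open>The clock value \<open>s\<close> is translated back into the time
      \<open>x\<close> elapsed within the step.\<close>
    define x where "x = (s - ?u (Inr i)) / ?\<rho>"
    have x: "0 \<le> x" "x < ?h" using that rho by (simp_all add: x_def field_simps)
    have s: "?u (Inr i) + ?\<rho> * x = s" using rho by (simp add: x_def)
    show ?thesis using unchanged_before_holding[of ?u x "Inr i"] clocks_nonneg x s by simp
  qed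
  have "eventually (\<lambda>s. s \<in> {?u (Inr i)<..<?a}) (at_left ?a)"
    using less by (rule eventually_at_left_real)
  then have "eventually (\<lambda>s. real (nd i s) = real (nd i (?u (Inr i)))) (at_left ?a)"
    by eventually_elim (use const in auto)
  then have "((\<lambda>s. real (nd i s)) \<longlongrightarrow> real (nd i (?u (Inr i)))) (at_left ?a)"
    by (rule tendsto_eventually)
  then have "Lim (at_left ?a) (\<lambda>s. real (nd i s)) = real (nd i (?u (Inr i)))"
    by (intro tendsto_Lim) auto
  then show ?thesis using nd_jumps[OF a, of i] by simp
qed simp

text \<open>Only departures lower a balance. If it is 0, the service rate is 0 and nobody leaves
  during the step; if it is positive, at most one customer leaves.\<close>

lemma balance_nonneg: "0 \<le> balance (counts N (clocks N r m)) i"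
proof (induction m)
  case 0
  show ?case by (simp add: net_balance_def counts_def nd_0 sum_nonneg)
next
  case (Suc m)
  let ?c = "counts N (clocks N r m)" and ?c' = "counts N (clocks N r (Suc m))"
  have c: "?c k \<le> ?c' k" for k by (rule counts_mono)
  have "(\<Sum>j\<in>UNIV. int (phi j i (?c (Inr j)))) \<le> (\<Sum>j\<in>UNIV. int (phi j i (?c' (Inr j))))"
    by (intro sum_mono) (simp add: phi_mono[OF c] del: clocks.simps)
  then have le: "balance ?c i + int (?c (Inr i)) - int (?c' (Inr i)) \<le> balance ?c' i"
    using c[of "Inl i"] by (simp add: net_balance_def del: clocks.simps)
  show ?case
  proof (cases "balance ?c i = 0")
    case True
    then have "net_state q0 phi ?c $ i = 0" by (simp add: net_state_def)
    then have "r ?c (Inr i) = 0" by (simp add: net_rate_def service_rates_def)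
    then have "?c' (Inr i) = ?c (Inr i)" by (simp add: counts_def)
    with le True show ?thesis by simp
  next
    case False
    moreover have "?c' (Inr i) \<le> ?c (Inr i) + 1"
      using departures_step[of i m] by (simp add: counts_def del: clocks.simps)
    ultimately show ?thesis using le Suc by linarith
  qed
qed

text \<open>Summed over all stations, endogenous arrivals are at most the departures, so routing
  creates no customers. The Euclidean norm is bounded by the sum of the coordinates.\<close>

lemma norm_net_state_le:
  "norm (real_vec (net_state q0 phi (counts N (clocks N r m)))) \<le>
     (\<Sum>i\<in>UNIV. real (q0 $ i)) + (\<Sum>i\<in>UNIV. real (na i (clocks N r m (Inl i))))"
proof -
  let ?c = "counts N (clocks N r m)"
  have "(\<Sum>i\<in>UNIV. \<Sum>j\<in>UNIV. int (phi j i (?c (Inr j)))) = (\<Sum>j\<in>UNIV. \<Sum>i\<in>UNIV. int (phi j i (?c (Inr j))))"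
    by (rule sum.swap)
  also have "\<dots> \<le> (\<Sum>j\<in>UNIV. int (?c (Inr j)))"
    by (intro sum_mono phi_sum_le)
  finally have "(\<Sum>i\<in>UNIV. balance ?c i) \<le> (\<Sum>i\<in>UNIV. int (q0 $ i)) + (\<Sum>i\<in>UNIV. int (?c (Inl i)))"
    by (simp add: net_balance_def sum.distrib sum_subtractf)
  then have "real_of_int (\<Sum>i\<in>UNIV. balance ?c i) \<le>
      real_of_int ((\<Sum>i\<in>UNIV. int (q0 $ i)) + (\<Sum>i\<in>UNIV. int (?c (Inl i))))"
    unfolding of_int_le_iff .
  then have le: "(\<Sum>i\<in>UNIV. real_of_int (balance ?c i)) \<le>
      (\<Sum>i\<in>UNIV. real (q0 $ i)) + (\<Sum>i\<in>UNIV. real (?c (Inl i)))"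
    by simp
  have "norm (real_vec (net_state q0 phi ?c)) \<le> (\<Sum>i\<in>UNIV. \<bar>real_vec (net_state q0 phi ?c) $ i\<bar>)"
    by (rule norm_le_l1_cart)
  also have "\<dots> = (\<Sum>i\<in>UNIV. real_of_int (balance ?c i))"
    using balance_nonneg[of m] by (intro sum.cong) (auto simp: real_vec_def net_state_def)
  finally show ?thesis using le by (simp add: counts_def)
qed

theorem network_equations_jump_path:
  assumes A: "0 \<le> A" "\<And>i t. 0 \<le> t \<Longrightarrow> real (na i t) \<le> A * (1 + t)"
    and L: "\<And>i x. x \<in> orthant \<Longrightarrow> lam i x \<le> L * (1 + norm x)"
      "\<And>i x. x \<in> orthant \<Longrightarrow> mu i x \<le> L * (1 + norm x)"
    and q: "\<And>t. 0 \<le> t \<Longrightarrow> q t = net_state q0 phi (jump_path N r t)"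
  shows "network_equations lam mu q0 na nd phi q"
proof (rule network_equations_of_clock_solution[OF clock_solution_jump_path _ q])
  define K where "K = real CARD('k + 'k)"
  define q0s where "q0s = (\<Sum>i\<in>UNIV. real (q0 $ i))"
  have L0: "0 \<le> L"
    using order_trans[OF lam_nonneg L(1), of 0] by (simp add: orthant_def)
  have q0s: "0 \<le> q0s" unfolding q0s_def by (intro sum_nonneg) simp
  have K0: "0 \<le> K" by (simp add: K_def)
  \<comment> \<open>There are \<open>K\<close> clocks, each of speed at most
    \<open>L * (1 + norm x)\<close>, with \<open>norm x\<close> at most
    \<open>q0s + K * A + A * U\<close> for the sum \<open>U\<close> of the clocks. The factor
    \<open>1 + U\<close> is then pulled out.\<close>
  define C where "C = K * L * (1 + q0s + K * A + A)"
  have "(\<Sum>k\<in>UNIV. r (counts N (clocks N r m)) k) \<le> C * (1 + (\<Sum>k\<in>UNIV. clocks N r m k))" for m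
  proof -
    let ?x = "real_vec (net_state q0 phi (counts N (clocks N r m)))"
    define U where "U = (\<Sum>k\<in>UNIV. clocks N r m k)"
    have U: "0 \<le> U" unfolding U_def by (intro sum_nonneg clocks_nonneg)
    have "(\<Sum>i\<in>UNIV. real (na i (clocks N r m (Inl i)))) \<le> (\<Sum>i\<in>(UNIV::'k set). A * (1 + clocks N r m (Inl i)))"
      by (intro sum_mono A(2) clocks_nonneg)
    also have "\<dots> = real CARD('k) * A + A * (\<Sum>i\<in>UNIV. clocks N r m (Inl i))"
      by (simp add: distrib_left sum.distrib sum_distrib_left)
    also have "\<dots> \<le> K * A + A * U"
    proof (intro add_mono mult_right_mono mult_left_mono A)
      show "real CARD('k) \<le> K" by (simp add: K_def)
      have "0 \<le> (\<Sum>i\<in>UNIV. clocks N r m (Inr i))" by (intro sum_nonneg clocks_nonneg)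
      moreover have "U = (\<Sum>i\<in>UNIV. clocks N r m (Inl i)) + (\<Sum>i\<in>UNIV. clocks N r m (Inr i))"
        unfolding U_def UNIV_sum by (subst sum.union_disjoint) (auto simp: sum.reindex)
      ultimately show "(\<Sum>i\<in>UNIV. clocks N r m (Inl i)) \<le> U" by simp
    qed
    finally have x: "norm ?x \<le> q0s + (K * A + A * U)"
      using norm_net_state_le[of m] by (simp add: q0s_def)
    have "r (counts N (clocks N r m)) k \<le> L * (1 + norm ?x)" for k
      using L(1)[OF real_vec_orthant] L(2)[OF real_vec_orthant] L0
      by (cases k) (auto simp: net_rate_def service_rates_def)
    then have "(\<Sum>k\<in>UNIV. r (counts N (clocks N r m)) k) \<le> (\<Sum>k\<in>(UNIV::('k + 'k) set). L * (1 + norm ?x))"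
      by (intro sum_mono)
    also have "\<dots> = K * (L * (1 + norm ?x))" by (simp add: K_def)
    also have "\<dots> \<le> K * (L * (1 + (q0s + (K * A + A * U))))"
      using x L0 K0 by (intro mult_left_mono) auto
    also have "\<dots> \<le> K * (L * ((1 + q0s + K * A + A) * (1 + U)))"
    proof (intro mult_left_mono K0 L0)
      have "0 \<le> (1 + q0s + K * A) * U + A"
        using q0s K0 A U by (intro add_nonneg_nonneg mult_nonneg_nonneg) auto
      then show "1 + (q0s + (K * A + A * U)) \<le> (1 + q0s + K * A + A) * (1 + U)"
        by (simp add: algebra_simps)
    qed
    finally show ?thesis by (simp add: C_def U_def mult.assoc)
  qed
  then show "\<exists>m. t < epoch N r m" for t by (rule epochs_unbounded)
  show "0 \<le> balance (jump_path N r t) i" for t i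
    unfolding jump_path_def by (rule balance_nonneg)
qed

theorem network_equations_unique:
  assumes "network_equations lam mu q0 na nd phi q" "network_equations lam mu q0 na nd phi q'" "0 \<le> t"
  shows "q t = q' t"
proof -
  obtain c c' where "clock_solution N r c" "clock_solution N r c'"
    "q t = net_state q0 phi (c t)" "q' t = net_state q0 phi (c' t)"
    using clock_solution_of_network_equations[OF assms(1)]
      clock_solution_of_network_equations[OF assms(2)] \<open>0 \<le> t\<close> by blast
  then show ?thesis using clock_solution_unique[of c c' t] \<open>0 \<le> t\<close> by simp
qed

end

section \<open>Linear growth\<close>

text \<open>For large times the ratio is bounded; before that, monotonicity bounds \<open>f\<close>
  by its value at a fixed time.\<close>

lemma linear_bound_of_Limsup:
  fixes f :: "real \<Rightarrow> nat"
  assumes mono: "mono_on {0..} f"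
    and lim: "Limsup at_top (\<lambda>t. ereal (real (f t) / t)) < \<infinity>"
  shows "\<exists>A\<ge>0. \<forall>t\<ge>0. real (f t) \<le> A * (1 + t)"
proof -
  obtain B :: nat where "Limsup at_top (\<lambda>t. ereal (real (f t) / t)) < ereal (real B)"
    using less_PInf_Ex_of_nat lim by auto
  then have "eventually (\<lambda>t. ereal (real (f t) / t) < ereal (real B)) at_top"
    by (rule Limsup_lessD)
  then obtain T where T: "\<And>t. t \<ge> T \<Longrightarrow> real (f t) / t < real B"
    by (auto simp: eventually_at_top_linorder)
  \<comment> \<open>The maximum with 1 makes \<open>t\<close> positive when the quotient is
    cleared.\<close>
  define T' where "T' = max T 1"
  define A where "A = max (real B) (real (f T'))"
  have "real (f t) \<le> A * (1 + t)" if t: "0 \<le> t" for t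
  proof (cases "t \<ge> T'")
    case True
    then have "real (f t) \<le> real B * t" using T[of t] by (simp add: T'_def field_simps)
    also have "\<dots> \<le> A * (1 + t)" using t by (intro mult_mono) (auto simp: A_def)
    finally show ?thesis .
  next
    case False
    then have "f t \<le> f T'" using t by (intro mono_onD[OF mono]) auto
    then have "real (f t) \<le> A * 1" by (simp add: A_def)
    also have "\<dots> \<le> A * (1 + t)" using t by (intro mult_left_mono) (auto simp: A_def)
    finally show ?thesis .
  qed
  moreover have "0 \<le> A" by (simp add: A_def)
  ultimately show ?thesis by blast
qed

text \<open>The supremum is evaluated at \<open>x / n\<close>. Undoing this scaling produces the
  factor \<open>n\<close> in \<open>L\<close>, and \<open>norm (x / n)\<close> is at most
  \<open>norm x\<close> because \<open>n\<close> is at least 1.\<close>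

lemma linear_growth_of_SUP:
  fixes f g :: "nat \<Rightarrow> real ^ 'k::finite \<Rightarrow> real"
  assumes sup: "(SUP n\<in>{1..}. SUP x\<in>orthant.
      ereal (f n (real n *\<^sub>R x) / (real n * (1 + norm x))
           + g n (real n *\<^sub>R x) / (real n * (1 + norm x)))) < \<infinity>"
    and n: "1 \<le> n"
    and nonneg: "\<And>x. x \<in> orthant \<Longrightarrow> 0 \<le> f n x" "\<And>x. x \<in> orthant \<Longrightarrow> 0 \<le> g n x"
  shows "\<exists>L\<ge>0. \<forall>x\<in>orthant. f n x \<le> L * (1 + norm x) \<and> g n x \<le> L * (1 + norm x)"
proof -
  obtain B :: nat where B: "(SUP n\<in>{1..}. SUP x\<in>orthant.
      ereal (f n (real n *\<^sub>R x) / (real n * (1 + norm x))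
           + g n (real n *\<^sub>R x) / (real n * (1 + norm x)))) < ereal (real B)"
    using less_PInf_Ex_of_nat sup by auto
  define L where "L = real B * real n"
  have "f n x \<le> L * (1 + norm x) \<and> g n x \<le> L * (1 + norm x)" if x: "x \<in> orthant" for x
  proof -
    define y where "y = x /\<^sub>R real n"
    have y: "y \<in> orthant" "real n *\<^sub>R y = x"
      using x n by (auto simp: y_def orthant_def)
    let ?e = "f n (real n *\<^sub>R y) / (real n * (1 + norm y)) + g n (real n *\<^sub>R y) / (real n * (1 + norm y))"
    have "ereal ?e \<le> (SUP x\<in>orthant. ereal (f n (real n *\<^sub>R x) / (real n * (1 + norm x))
           + g n (real n *\<^sub>R x) / (real n * (1 + norm x))))"
      using y(1) by (rule SUP_upper)
    also have "\<dots> \<le> (SUP n\<in>{1..}. SUP x\<in>orthant. ereal (f n (real n *\<^sub>R x) / (real n * (1 + norm x))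
           + g n (real n *\<^sub>R x) / (real n * (1 + norm x))))"
      by (rule SUP_upper[where f="\<lambda>n. SUP x\<in>orthant. ereal (f n (real n *\<^sub>R x) / (real n * (1 + norm x))
           + g n (real n *\<^sub>R x) / (real n * (1 + norm x)))"]) (use n in simp)
    finally have "ereal ?e < ereal (real B)" using B by (rule le_less_trans)
    then have e: "(f n x + g n x) / (real n * (1 + norm y)) < real B"
      by (simp add: y add_divide_distrib)
    have pos: "0 < real n * (1 + norm y)"
      using n by (intro mult_pos_pos) (auto intro: add_pos_nonneg)
    have "f n x + g n x \<le> real B * (real n * (1 + norm y))"
      using e pos by (simp add: pos_divide_less_eq)
    also have "\<dots> \<le> L * (1 + norm x)"
    proof -
      have "norm y \<le> norm x"
        using n mult_left_mono[of 1 "real n" "norm x"] by (simp add: y_def field_simps)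
      then have "L * (1 + norm y) \<le> L * (1 + norm x)" by (intro mult_left_mono) (auto simp: L_def)
      then show ?thesis by (simp add: L_def mult.assoc)
    qed
    finally show ?thesis using nonneg[OF x] by simp
  qed
  moreover have "0 \<le> L" by (simp add: L_def)
  ultimately show ?thesis by blast
qed

section \<open>The solution as a function of the primitives\<close>

definition routing_data :: "'k::finite primitive_data \<Rightarrow> 'k \<Rightarrow> 'k \<Rightarrow> nat \<Rightarrow> nat" where
  "routing_data p i j m = snd (snd (snd p)) (i, j) m"

text \<open>The paths in \<open>primitive_space\<close> are real-valued; rounding makes counters of
  all of them and changes nothing on paths with values in the naturals.\<close>

definition counter_data :: "'k::finite primitive_data \<Rightarrow> 'k + 'k \<Rightarrow> real \<Rightarrow> nat" where
  "counter_data p = case_sum (\<lambda>i v. nat \<lfloor>fst (snd p) i v\<rfloor>) (\<lambda>i v. nat \<lfloor>fst (snd (snd p)) i v\<rfloor>)"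

definition network_flow ::
    "('k::finite \<Rightarrow> real ^ 'k \<Rightarrow> real) \<Rightarrow> ('k \<Rightarrow> real ^ 'k \<Rightarrow> real) \<Rightarrow> 'k primitive_data \<Rightarrow>
      real \<Rightarrow> nat ^ 'k" where
  "network_flow lam mu p = (\<lambda>t\<in>{0..}. net_state (fst p) (routing_data p)
     (jump_path (counter_data p) (net_rate lam mu (fst p) (routing_data p)) t))"

lemma measurable_primitive_components:
  shows "fst \<in> measurable primitive_space (count_space (UNIV :: (nat ^ 'k::finite) set))"
    and "(\<lambda>p::'k primitive_data. fst (snd p) i) \<in> measurable primitive_space skorohod_space"
    and "(\<lambda>p::'k primitive_data. fst (snd (snd p)) i) \<in> measurable primitive_space skorohod_space"
    and "(\<lambda>p::'k primitive_data. routing_data p i j m) \<in> measurable primitive_space (count_space UNIV)"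
proof -
  show "fst \<in> measurable primitive_space (count_space (UNIV :: (nat ^ 'k) set))"
    unfolding primitive_space_def by (rule measurable_fst)
  show "(\<lambda>p::'k primitive_data. fst (snd p) i) \<in> measurable primitive_space skorohod_space"
    unfolding primitive_space_def
    by (rule measurable_compose[OF _ measurable_component_singleton[of i UNIV "\<lambda>_. skorohod_space"]])
      (intro measurable_compose[OF measurable_snd] measurable_fst measurable_snd UNIV_I)+
  show "(\<lambda>p::'k primitive_data. fst (snd (snd p)) i) \<in> measurable primitive_space skorohod_space"
    unfolding primitive_space_def
    by (rule measurable_compose[OF _ measurable_component_singleton[of i UNIV "\<lambda>_. skorohod_space"]])
      (intro measurable_compose[OF measurable_snd] measurable_fst measurable_snd UNIV_I)+
  have "(\<lambda>p::'k primitive_data. snd (snd (snd p)) (i, j))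
      \<in> measurable primitive_space (PiM UNIV (\<lambda>_. count_space UNIV))"
    unfolding primitive_space_def
    by (rule measurable_compose[OF _ measurable_component_singleton[of "(i, j)" UNIV "\<lambda>_. PiM UNIV (\<lambda>_. count_space UNIV)"]])
      (intro measurable_compose[OF measurable_snd] measurable_fst measurable_snd UNIV_I)+
  then show "(\<lambda>p::'k primitive_data. routing_data p i j m) \<in> measurable primitive_space (count_space UNIV)"
    unfolding routing_data_def
    by (rule measurable_compose[OF _ measurable_component_singleton[of m UNIV "\<lambda>_. count_space UNIV"]]) simp
qed

lemma measurable_net_state:
  "(\<lambda>p::'k::finite primitive_data. net_state (fst p) (routing_data p) c)
     \<in> measurable primitive_space (count_space UNIV)"
proof (subst measurable_count_space_eq2_countable, intro conjI ballI)
  note [measurable] = measurable_primitive_components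
  have [measurable]: "(\<lambda>p::'k primitive_data. real (fst p $ i)) \<in> borel_measurable primitive_space" for i
    by (rule measurable_compose[OF measurable_primitive_components(1)]) simp
  have [measurable]: "(\<lambda>p::'k primitive_data. real_of_int (net_balance (fst p) (routing_data p) c i))
      \<in> borel_measurable primitive_space" for i
    unfolding net_balance_def by simp
  fix q :: "nat ^ 'k"
  \<comment> \<open>The truncation is rewritten as a maximum of reals, so that the event is
    expressed by Borel functions.\<close>
  have nat_eq: "nat b = a \<longleftrightarrow> max 0 (real_of_int b) = real a" for a b by auto
  have "(\<lambda>p::'k primitive_data. net_state (fst p) (routing_data p) c) -` {q} \<inter> space primitive_space =
      {p \<in> space primitive_space. \<forall>i.
         max 0 (real_of_int (net_balance (fst p) (routing_data p) c i)) = real (q $ i)}"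
    by (auto simp: vec_eq_iff net_state_def nat_eq)
  also have "\<dots> \<in> sets primitive_space" by measurable
  finally show "(\<lambda>p::'k primitive_data. net_state (fst p) (routing_data p) c) -` {q} \<inter> space primitive_space
      \<in> sets primitive_space" .
qed auto

lemma measurable_network_flow:
  fixes lam mu :: "'k::finite \<Rightarrow> real ^ 'k \<Rightarrow> real"
  assumes "\<And>i x. x \<in> orthant \<Longrightarrow> 0 \<le> lam i x" "\<And>i x. x \<in> orthant \<Longrightarrow> 0 \<le> mu i x"
  shows "network_flow lam mu \<in> measurable primitive_space (PiM {0..} (\<lambda>_. count_space UNIV))"
proof -
  interpret measurable_clock_data "primitive_space :: 'k primitive_data measure" counter_data
    "\<lambda>p. net_rate lam mu (fst p) (routing_data p)"
  proof
    fix v :: "'k primitive_data \<Rightarrow> real" and k :: "'k + 'k"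
    assume v: "v \<in> borel_measurable primitive_space" "\<And>p. p \<in> space primitive_space \<Longrightarrow> 0 \<le> v p"
    show "(\<lambda>p. counter_data p k (v p)) \<in> measurable primitive_space (count_space UNIV)"
    proof (cases k)
      case (Inl i)
      note [measurable] = measurable_skorohod_eval[OF measurable_primitive_components(2) v, of i]
      show ?thesis unfolding counter_data_def Inl by simp
    next
      case (Inr i)
      note [measurable] = measurable_skorohod_eval[OF measurable_primitive_components(3) v, of i]
      show ?thesis unfolding counter_data_def Inr by simp
    qed
  next
    fix c and k :: "'k + 'k"
    show "(\<lambda>p::'k primitive_data. net_rate lam mu (fst p) (routing_data p) c k) \<in> borel_measurable primitive_space"
      unfolding net_rate_def by (rule measurable_compose[OF measurable_net_state]) simp
    show "0 \<le> net_rate lam mu (fst p) (routing_data p) c k" for p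
      unfolding net_rate_def by (rule service_rates_nonneg[OF assms])
  qed
  show ?thesis
    unfolding network_flow_def
    by (intro measurable_restrict measurable_compose_countable[OF measurable_net_state measurable_jump_path])
qed

section \<open>From paths to the probability space\<close>

context network_primitives
begin

lemma measurable_primitive_element: "primitive_element Q0 NA ND Phi \<in> measurable M primitive_space"
proof -
  have sk: "(\<lambda>\<omega>. \<lambda>t\<in>{0..}. real (X t \<omega>)) \<in> measurable M skorohod_space"
    if X: "\<And>t. 0 \<le> t \<Longrightarrow> X t \<in> measurable M (count_space UNIV)"
      and c: "\<And>\<omega>. \<omega> \<in> space M \<Longrightarrow> cadlag (\<lambda>t. real (X t \<omega>))" for X :: "real \<Rightarrow> _ \<Rightarrow> nat"
    unfolding skorohod_space_def
  proof (rule measurable_restrict_space2)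
    show "(\<lambda>\<omega>. \<lambda>t\<in>{0..}. real (X t \<omega>)) \<in> measurable M (PiM {0..} (\<lambda>_. borel))"
      by (intro measurable_restrict measurable_compose[OF X]) auto
  qed (use c cadlag_restrict in auto)
  have PiM_UNIV: "(\<lambda>\<omega> i. Y i \<omega>) \<in> measurable M (PiM UNIV (\<lambda>_. L))"
    if "\<And>i. Y i \<in> measurable M L" for Y and L
    using measurable_restrict[of UNIV Y M "\<lambda>_. L"] that by (simp add: restrict_def)
  show ?thesis
    unfolding primitive_element_def primitive_space_def split_def
    by (intro measurable_Pair PiM_UNIV sk Q0_measurable NA_measurable ND_measurable NA_cadlag
        ND_cadlag Phi_measurable)
qed

lemma network_path:
  assumes "\<omega> \<in> space M"
  shows "network_path lam mu (\<lambda>i t. NA i t \<omega>) (\<lambda>i t. ND i t \<omega>) (\<lambda>i j m. Phi i j m \<omega>)"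
  by unfold_locales
    (intro lam_nonneg mu_nonneg NA_mono NA_cadlag ND_0 ND_mono ND_cadlag ND_jumps Phi_0
      Phi_increment Phi_route assms | assumption)+

lemma network_flow_primitive_element:
  assumes "0 \<le> t"
  shows "network_flow lam mu (primitive_element Q0 NA ND Phi \<omega>) t =
    net_state (Q0 \<omega>) (\<lambda>i j m. Phi i j m \<omega>)
      (jump_path (case_sum (\<lambda>i t. NA i t \<omega>) (\<lambda>i t. ND i t \<omega>))
        (net_rate lam mu (Q0 \<omega>) (\<lambda>i j m. Phi i j m \<omega>)) t)"
proof -
  let ?p = "primitive_element Q0 NA ND Phi \<omega>"
  have phi: "routing_data ?p = (\<lambda>i j m. Phi i j m \<omega>)" and q: "fst ?p = Q0 \<omega>"
    by (simp_all add: routing_data_def primitive_element_def fun_eq_iff)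
  have "counter_data ?p k v = case_sum (\<lambda>i t. NA i t \<omega>) (\<lambda>i t. ND i t \<omega>) k v" if "0 \<le> v" for k v
    using that by (cases k) (auto simp: counter_data_def primitive_element_def)
  then have "jump_path (counter_data ?p) (net_rate lam mu (Q0 \<omega>) (\<lambda>i j m. Phi i j m \<omega>)) t =
      jump_path (case_sum (\<lambda>i t. NA i t \<omega>) (\<lambda>i t. ND i t \<omega>))
        (net_rate lam mu (Q0 \<omega>) (\<lambda>i j m. Phi i j m \<omega>)) t"
    by (intro jump_path_cong) (auto simp: net_rate_def intro!: service_rates_nonneg lam_nonneg mu_nonneg)
  with assms show ?thesis by (simp add: network_flow_def phi q)
qed

text \<open>Stations outside \<open>J\<close> have the counter
  \<open>nat \<lfloor>t\<rfloor>\<close>, which is at most \<open>1 + t\<close>. The sum of the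
  constants of all stations serves each of them.\<close>

lemma exogenous_linear_bound:
  assumes \<omega>: "\<omega> \<in> space M"
    and lim: "\<And>i. i \<in> J \<Longrightarrow> Limsup at_top (\<lambda>t::real. ereal (real (NA i t \<omega>) / t)) < \<infinity>"
  shows "\<exists>A\<ge>0. \<forall>i. \<forall>t\<ge>0. real (NA i t \<omega>) \<le> A * (1 + t)"
proof -
  have "\<exists>A\<ge>0. \<forall>t\<ge>0. real (NA i t \<omega>) \<le> A * (1 + t)" for i
  proof (cases "i \<in> J")
    case True
    then show ?thesis using linear_bound_of_Limsup[OF NA_mono[OF \<omega>] lim] by blast
  next
    case False
    have "real (NA i t \<omega>) \<le> 1 * (1 + t)" if "0 \<le> t" for t
    proof -
      have "real (nat \<lfloor>t\<rfloor>) \<le> t" using that by (simp add: of_nat_nat)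
      then show ?thesis using NA_floor[OF False \<omega> that] by simp
    qed
    then show ?thesis by (intro exI[of _ 1]) auto
  qed
  then obtain A where A: "\<And>i. 0 \<le> A i" "\<And>i t. 0 \<le> t \<Longrightarrow> real (NA i t \<omega>) \<le> A i * (1 + t)"
    by metis
  have "real (NA i t \<omega>) \<le> (\<Sum>j\<in>UNIV. A j) * (1 + t)" if "0 \<le> t" for i t
  proof -
    have "A i \<le> (\<Sum>j\<in>UNIV. A j)" by (intro member_le_sum) (auto simp: A)
    then have "A i * (1 + t) \<le> (\<Sum>j\<in>UNIV. A j) * (1 + t)" using that by (intro mult_right_mono) auto
    with A(2)[OF that, of i] show ?thesis by simp
  qed
  moreover have "0 \<le> (\<Sum>j\<in>UNIV. A j)" by (intro sum_nonneg A)
  ultimately show ?thesis by blast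
qed

text \<open>The solution is defined as the flow of the primitives, so its representation by
  \<open>F\<close> holds at every sample point; the equations hold where the growth condition does,
  which is almost everywhere since \<open>J\<close> is finite.\<close>

theorem strong_network_solution_flow:
  assumes lim: "\<And>i. i \<in> J \<Longrightarrow> AE \<omega> in M. Limsup at_top (\<lambda>t::real. ereal (real (NA i t \<omega>) / t)) < \<infinity>"
    and L: "\<And>i x. x \<in> orthant \<Longrightarrow> lam i x \<le> L * (1 + norm x)"
      "\<And>i x. x \<in> orthant \<Longrightarrow> mu i x \<le> L * (1 + norm x)"
  shows "strong_network_solution M lam mu Q0 NA ND Phi
    (\<lambda>t \<omega>. network_flow lam mu (primitive_element Q0 NA ND Phi \<omega>) t)"
  unfolding strong_network_solution_def network_solution_def
proof (intro conjI allI impI)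
  have flow: "network_flow lam mu \<in> measurable primitive_space (PiM {0..} (\<lambda>_. count_space UNIV))"
    by (rule measurable_network_flow) (auto intro: lam_nonneg mu_nonneg)
  then show "\<exists>F\<in>measurable primitive_space (PiM {0..} (\<lambda>_. count_space UNIV)).
      \<forall>\<omega>\<in>space M. \<forall>t\<ge>0. network_flow lam mu (primitive_element Q0 NA ND Phi \<omega>) t =
        F (primitive_element Q0 NA ND Phi \<omega>) t"
    by blast
  show "(\<lambda>\<omega>. network_flow lam mu (primitive_element Q0 NA ND Phi \<omega>) t) \<in> measurable M (count_space UNIV)"
    if "0 \<le> t" for t
    using measurable_compose[OF measurable_compose[OF measurable_primitive_element flow]
        measurable_component_singleton[of t "{0..}"]] that by simp
  have "AE \<omega> in M. \<forall>i\<in>J. Limsup at_top (\<lambda>t::real. ereal (real (NA i t \<omega>) / t)) < \<infinity>"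
    using lim by (simp add: AE_finite_all)
  with AE_space show "AE \<omega> in M. network_equations lam mu (Q0 \<omega>) (\<lambda>i t. NA i t \<omega>) (\<lambda>i t. ND i t \<omega>)
      (\<lambda>i j m. Phi i j m \<omega>) (\<lambda>t. network_flow lam mu (primitive_element Q0 NA ND Phi \<omega>) t)"
  proof eventually_elim
    case (elim \<omega>)
    interpret path: network_path lam mu "Q0 \<omega>" "\<lambda>i t. NA i t \<omega>" "\<lambda>i t. ND i t \<omega>" "\<lambda>i j m. Phi i j m \<omega>"
      by (rule network_path[OF elim(1)])
    obtain A where "0 \<le> A" "\<And>i t. 0 \<le> t \<Longrightarrow> real (NA i t \<omega>) \<le> A * (1 + t)"
      using exogenous_linear_bound[OF elim(1)] elim(2) by blast
    then show ?case
      by (rule path.network_equations_jump_path[OF _ _ L]) (auto intro: network_flow_primitive_element)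
  qed
qed

theorem network_solution_unique:
  assumes "network_solution M lam mu Q0 NA ND Phi Q" "network_solution M lam mu Q0 NA ND Phi Q'"
  shows "AE \<omega> in M. \<forall>t\<ge>0. Q t \<omega> = Q' t \<omega>"
proof -
  have "AE \<omega> in M. network_equations lam mu (Q0 \<omega>) (\<lambda>i t. NA i t \<omega>) (\<lambda>i t. ND i t \<omega>)
      (\<lambda>i j m. Phi i j m \<omega>) (\<lambda>t. X t \<omega>)" if "network_solution M lam mu Q0 NA ND Phi X" for X
    using that by (simp add: network_solution_def)
  from AE_space this[OF assms(1)] this[OF assms(2)] show ?thesis
    by eventually_elim (use network_path.network_equations_unique[OF network_path] in blast)
qed

end

theorem lemma2p1:
  fixes M :: "'w measure"
    and J :: "'k::finite set"
    and lam mu :: "nat \<Rightarrow> 'k \<Rightarrow> real ^ 'k \<Rightarrow> real"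
    and Q0 :: "nat \<Rightarrow> 'w \<Rightarrow> nat ^ 'k"
    and NA ND :: "nat \<Rightarrow> 'k \<Rightarrow> real \<Rightarrow> 'w \<Rightarrow> nat"
    and Phi :: "nat \<Rightarrow> 'k \<Rightarrow> 'k \<Rightarrow> nat \<Rightarrow> 'w \<Rightarrow> nat"
  assumes primitives:
      "\<And>n. n \<ge> 1 \<Longrightarrow> network_primitives M J (lam n) (mu n) (Q0 n) (NA n) (ND n) (Phi n)"
    and A0: "\<And>n i. n \<ge> 1 \<Longrightarrow> i \<in> J \<Longrightarrow>
      AE \<omega> in M. Limsup at_top (\<lambda>t::real. ereal (real (NA n i t \<omega>) / t)) < \<infinity>"
    and A2: "\<And>i. (SUP n\<in>{1..}. SUP x\<in>orthant.
      ereal (lam n i (real n *\<^sub>R x) / (real n * (1 + norm x))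
           + mu n i (real n *\<^sub>R x) / (real n * (1 + norm x)))) < \<infinity>"
  shows "\<forall>n\<ge>1.
      (\<exists>Q. strong_network_solution M (lam n) (mu n) (Q0 n) (NA n) (ND n) (Phi n) Q) \<and>
      (\<forall>Q Q'. network_solution M (lam n) (mu n) (Q0 n) (NA n) (ND n) (Phi n) Q \<longrightarrow>
              network_solution M (lam n) (mu n) (Q0 n) (NA n) (ND n) (Phi n) Q' \<longrightarrow>
              (AE \<omega> in M. \<forall>t\<ge>0. Q t \<omega> = Q' t \<omega>))"
proof (intro allI impI conjI)
  fix n :: nat assume n: "n \<ge> 1"
  interpret network_primitives M J "lam n" "mu n" "Q0 n" "NA n" "ND n" "Phi n"
    using n by (rule primitives)
  have "\<exists>L\<ge>0. \<forall>x\<in>orthant. lam n i x \<le> L * (1 + norm x) \<and> mu n i x \<le> L * (1 + norm x)" for i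
    by (rule linear_growth_of_SUP[OF A2 n]) (auto intro: lam_nonneg mu_nonneg)
  then obtain L where L: "\<And>i. 0 \<le> L i"
    "\<And>i x. x \<in> orthant \<Longrightarrow> lam n i x \<le> L i * (1 + norm x)"
    "\<And>i x. x \<in> orthant \<Longrightarrow> mu n i x \<le> L i * (1 + norm x)"
    by metis
  \<comment> \<open>The growth assumption gives one constant for each station; their sum is a common
    one.\<close>
  have "L i * (1 + norm x) \<le> (\<Sum>j\<in>UNIV. L j) * (1 + norm x)" for i and x :: "real ^ 'k"
    by (intro mult_right_mono member_le_sum) (auto simp: L)
  then have "strong_network_solution M (lam n) (mu n) (Q0 n) (NA n) (ND n) (Phi n)
      (\<lambda>t \<omega>. network_flow (lam n) (mu n) (primitive_element (Q0 n) (NA n) (ND n) (Phi n) \<omega>) t)"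
    using n by (intro strong_network_solution_flow[of "\<Sum>j\<in>UNIV. L j"] A0)
      (auto intro: order_trans[OF L(2)] order_trans[OF L(3)])
  then show "\<exists>Q. strong_network_solution M (lam n) (mu n) (Q0 n) (NA n) (ND n) (Phi n) Q" by blast
qed (use primitives network_primitives.network_solution_unique in blast)

end
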